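(* Let $T\ge 1$ be an integer, let $v_1,c_t,p_t\in\mathbb{R}$ and $h_t,b_t\ge 0$ for $t\in[T]$, and let $\mathcal{U}_t=[\underline{D}_t,\bar{D}_t]$ for $t\in[T+1]$ with $\underline{D}_1=\bar{D}_1=1$ and $\underline{D}_t<\bar{D}_t$ for all $t\ge 2$. Consider the linear decision rule problem for the dynamic newsvendor problem: minimize over $\mathbf y=(y_{t,s})_{1\le s\le t\le T}$ with real entries the worst-case cost $$\max_{\zeta_1\in\mathcal{U}_1,\dots,\zeta_{T+1}\in\mathcal{U}_{T+1}}\ \sum_{t=1}^T\Big(c_t x_t+h_t\Big[v_1+\sum_{s=1}^t x_s-\sum_{s=2}^{t+1}\zeta_s\Big]^+ + b_t\Big[-v_1-\sum_{s=1}^t x_s+\sum_{s=2}^{t+1}\zeta_s\Big]^+\Big),\qquad x_t=\sum_{s=1}^t y_{t,s}\zeta_s,$$ subject to $0\le \sum_{s=1}^t y_{t,s}\zeta_s\le p_t$ for all $t\in[T]$ and all $\zeta_1\in\mathcal{U}_1,\dots,\zeta_{T+1}\in\mathcal{U}_{T+1}$. Suppose this problem is feasible and its optimal objective value is finite. Then it has an optimal solution $\bar{\mathbf y}$ that satisfies $$\|\bar{\mathbf y}\|_0\le 10+12T.$$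
   Context: $[k]=\{1,\dots,k\}$; $[a]^+=\max\{a,0\}$; $\|\mathbf y\|_0$ denotes the number of nonzero entries of $\mathbf y$. Here $h_t$ and $b_t$ are holding and backorder costs, $c_t$ is the per-unit production cost, $p_t$ is the production capacity, and $v_1$ is the initial inventory. *)

theory Defs
  imports "HOL-Analysis.Analysis"
begin

text \<open>
  Indexed families such as the costs \<open>c\<close>, capacities \<open>p\<close> or demands \<open>\<zeta>\<close> are functions on the natural numbers, of which only
  the values at the indices named in the model are used.  In particular, a linear decision rule
  is a function \<open>y :: nat \<Rightarrow> nat \<Rightarrow> real\<close> of which only the entries \<open>y t s\<close> with
  \<open>1 \<le> s \<le> t \<le> T\<close> matter.
\<close>

definition uncertainty_set :: "nat \<Rightarrow> (nat \<Rightarrow> real) \<Rightarrow> (nat \<Rightarrow> real) \<Rightarrow> (nat \<Rightarrow> real) set" where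
  "uncertainty_set T Dlo Dhi = (\<Pi>\<^sub>E t\<in>{1..T+1}. {Dlo t..Dhi t})"

definition ldr_order :: "(nat \<Rightarrow> nat \<Rightarrow> real) \<Rightarrow> (nat \<Rightarrow> real) \<Rightarrow> nat \<Rightarrow> real" where
  "ldr_order y \<zeta> t = (\<Sum>s=1..t. y t s * \<zeta> s)"

definition newsvendor_cost ::
  "nat \<Rightarrow> real \<Rightarrow> (nat \<Rightarrow> real) \<Rightarrow> (nat \<Rightarrow> real) \<Rightarrow> (nat \<Rightarrow> real) \<Rightarrow>
   (nat \<Rightarrow> real) \<Rightarrow> (nat \<Rightarrow> real) \<Rightarrow> real" where
  "newsvendor_cost T v1 c h b x \<zeta> =
     (\<Sum>t=1..T. c t * x t
        + h t * max (v1 + (\<Sum>s=1..t. x s) - (\<Sum>s=2..t+1. \<zeta> s)) 0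
        + b t * max (- v1 - (\<Sum>s=1..t. x s) + (\<Sum>s=2..t+1. \<zeta> s)) 0)"

text \<open>The supremum below is a maximum; see \<open>worst_case_cost_attained\<close>.\<close>

definition worst_case_cost ::
  "nat \<Rightarrow> real \<Rightarrow> (nat \<Rightarrow> real) \<Rightarrow> (nat \<Rightarrow> real) \<Rightarrow> (nat \<Rightarrow> real) \<Rightarrow>
   (nat \<Rightarrow> real) \<Rightarrow> (nat \<Rightarrow> real) \<Rightarrow> (nat \<Rightarrow> nat \<Rightarrow> real) \<Rightarrow> real" where
  "worst_case_cost T v1 c h b Dlo Dhi y =
     (SUP \<zeta>\<in>uncertainty_set T Dlo Dhi. newsvendor_cost T v1 c h b (ldr_order y \<zeta>) \<zeta>)"

definition ldr_feasible ::
  "nat \<Rightarrow> (nat \<Rightarrow> real) \<Rightarrow> (nat \<Rightarrow> real) \<Rightarrow> (nat \<Rightarrow> real) \<Rightarrow> (nat \<Rightarrow> nat \<Rightarrow> real) set" where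
  "ldr_feasible T p Dlo Dhi =
     {y. \<forall>t\<in>{1..T}. \<forall>\<zeta>\<in>uncertainty_set T Dlo Dhi. 0 \<le> ldr_order y \<zeta> t \<and> ldr_order y \<zeta> t \<le> p t}"

definition ldr_optimal_value ::
  "nat \<Rightarrow> real \<Rightarrow> (nat \<Rightarrow> real) \<Rightarrow> (nat \<Rightarrow> real) \<Rightarrow> (nat \<Rightarrow> real) \<Rightarrow> (nat \<Rightarrow> real) \<Rightarrow>
   (nat \<Rightarrow> real) \<Rightarrow> (nat \<Rightarrow> real) \<Rightarrow> ereal" where
  "ldr_optimal_value T v1 c p h b Dlo Dhi =
     (INF y\<in>ldr_feasible T p Dlo Dhi. ereal (worst_case_cost T v1 c h b Dlo Dhi y))"

definition ldr_optimal_solution ::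
  "nat \<Rightarrow> real \<Rightarrow> (nat \<Rightarrow> real) \<Rightarrow> (nat \<Rightarrow> real) \<Rightarrow> (nat \<Rightarrow> real) \<Rightarrow> (nat \<Rightarrow> real) \<Rightarrow>
   (nat \<Rightarrow> real) \<Rightarrow> (nat \<Rightarrow> real) \<Rightarrow> (nat \<Rightarrow> nat \<Rightarrow> real) \<Rightarrow> bool" where
  "ldr_optimal_solution T v1 c p h b Dlo Dhi y \<longleftrightarrow>
     y \<in> ldr_feasible T p Dlo Dhi \<and>
     (\<forall>y'\<in>ldr_feasible T p Dlo Dhi.
        worst_case_cost T v1 c h b Dlo Dhi y \<le> worst_case_cost T v1 c h b Dlo Dhi y')"

definition ldr_nnz :: "nat \<Rightarrow> (nat \<Rightarrow> nat \<Rightarrow> real) \<Rightarrow> nat" where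
  "ldr_nnz T y = card {(t, s). 1 \<le> s \<and> s \<le> t \<and> t \<le> T \<and> y t s \<noteq> 0}"

lemma finite_ldr_support:
  fixes y :: "nat \<Rightarrow> nat \<Rightarrow> real"
  shows "finite {(t, s). 1 \<le> s \<and> s \<le> t \<and> t \<le> T \<and> y t s \<noteq> 0}"
  by (rule finite_subset[of _ "{..T} \<times> {..T}"]) auto

lemma compact_uncertainty_set: "compact (uncertainty_set T Dlo Dhi)"
proof -
  have "compactin (product_topology (\<lambda>_. euclidean) UNIV)
      (\<Pi>\<^sub>E t\<in>UNIV. if t \<in> {1..T+1} then {Dlo t..Dhi t} else {undefined})"
    unfolding compactin_PiE by auto
  moreover have "(\<Pi>\<^sub>E t\<in>UNIV. if t \<in> {1..T+1} then {Dlo t..Dhi t} else {undefined})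
      = uncertainty_set T Dlo Dhi"
    unfolding uncertainty_set_def by (auto simp: PiE_def Pi_def extensional_def split: if_splits)
  ultimately show ?thesis
    by (simp add: euclidean_product_topology)
qed

lemma worst_case_cost_attained:
  assumes "\<And>t. t \<in> {1..T+1} \<Longrightarrow> Dlo t \<le> Dhi t"
  obtains \<zeta> where "\<zeta> \<in> uncertainty_set T Dlo Dhi"
    and "worst_case_cost T v1 c h b Dlo Dhi y = newsvendor_cost T v1 c h b (ldr_order y \<zeta>) \<zeta>"
    and "\<And>\<zeta>'. \<zeta>' \<in> uncertainty_set T Dlo Dhi \<Longrightarrow>
      newsvendor_cost T v1 c h b (ldr_order y \<zeta>') \<zeta>' \<le> newsvendor_cost T v1 c h b (ldr_order y \<zeta>) \<zeta>"
proof -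
  let ?U = "uncertainty_set T Dlo Dhi"
  let ?f = "\<lambda>\<zeta>. newsvendor_cost T v1 c h b (ldr_order y \<zeta>) \<zeta>"
  have ne: "?U \<noteq> {}"
    using assms by (auto simp: uncertainty_set_def PiE_eq_empty_iff)
  have coord: "continuous_on ?U (\<lambda>\<zeta>. \<zeta> s)" for s
    by (rule continuous_on_subset[OF continuous_on_product_coordinates]) simp
  have "continuous_on ?U ?f"
    unfolding newsvendor_cost_def ldr_order_def by (intro continuous_intros coord)
  from continuous_attains_sup[OF compact_uncertainty_set ne this]
  obtain \<zeta> where \<zeta>: "\<zeta> \<in> ?U" "\<And>\<zeta>'. \<zeta>' \<in> ?U \<Longrightarrow> ?f \<zeta>' \<le> ?f \<zeta>"
    by blast
  have "worst_case_cost T v1 c h b Dlo Dhi y = ?f \<zeta>"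
    unfolding worst_case_cost_def using \<zeta> by (intro cSup_eq_maximum) auto
  with \<zeta> show thesis by (intro that) auto
qed

end

theory Submission
  imports Defs
begin

text \<open>
  Write \<open>\<zeta> s = Dlo s + gap s * u s\<close> with \<open>u\<close> in the unit box, and let \<open>J\<close> be the cost-to-go of the fully adaptive
  problem, in which an order may depend in any way on the demands seen before. An adversary who answers each order with
  the worse endpoint of the next demand interval shows that no decision rule costs less than the initial value of
  \<open>J\<close> (\<open>cost_to_go_lower_bound\<close>). It remains to find a linear rule with few nonzero entries that costs no more.

  The rule is built forward in time, along the lines of the argument of Bertsimas, Iancu and Parrilo that affine policies
  are optimal for such problems. Before each period the cost so far is bounded by an affine function \<open>A\<close> of \<open>u\<close>, the
  inventory is an affine function \<open>I\<close> that is nonincreasing in every coordinate, and \<open>A u + J (I u)\<close> is at most the initial value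
  of \<open>J\<close> on the whole box. Two replacements preserve this invariant: \<open>order_step\<close> replaces the optimal order, which is
  only piecewise linear in the inventory, by an affine one, and \<open>cost_step\<close> replaces the holding and backorder cost by an affine
  upper bound. Both rest on the same picture. For a given inventory the adversary wants the largest \<open>A\<close>, so only the concave upper
  boundary of the set of pairs \<open>(I u, A u)\<close> matters; its edges are the coordinates of \<open>u\<close> sorted by the ratio of their two slopes. The
  affine coefficients are chosen so that the ratios of the coordinates near the kink become equal. A piece of the boundary
  then turns into a straight segment, at whose ends nothing has changed, and inside which the convexity of \<open>J\<close> gives the bound.

  Sparsity comes from linear programming. The slopes of the affine stage cost bounds have the form \<open>- \<gamma> * unserved\<close>, where
  \<open>unserved\<close> is linear in the coefficients of the orders. Once \<open>\<gamma>\<close> and all intercepts are fixed, the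
  coefficients only have to be nonnegative and to keep the values of \<open>4 * T\<close> linear functionals (\<open>certificate_sparse\<close>),
  so at most \<open>4 * T\<close> of them need to be nonzero (\<open>sparse_nonneg_solution\<close>). With the \<open>T\<close> intercepts this
  makes \<open>5 * T\<close> nonzero entries.
\<close>

section \<open>Greedy exchange on a box\<close>

definition unit_box :: "('a \<Rightarrow> real) set" where
  "unit_box = {u. \<forall>s. 0 \<le> u s \<and> u s \<le> 1}"

lemma unit_boxD: "u \<in> unit_box \<Longrightarrow> 0 \<le> u s" "u \<in> unit_box \<Longrightarrow> u s \<le> 1"
  by (auto simp: unit_box_def)

lemma unit_box_complement: "u \<in> unit_box \<Longrightarrow> (\<lambda>s. 1 - u s) \<in> unit_box"
  by (auto simp: unit_box_def)

lemma unit_box_scale: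
  assumes "u \<in> unit_box" "0 \<le> r" "r \<le> 1"
  shows "(\<lambda>s. r * u s) \<in> unit_box"
  using assms by (auto simp: unit_box_def intro: mult_le_one)

lemma unit_box_indicator: "(\<lambda>s. if P s then 1 else 0) \<in> unit_box"
  by (auto simp: unit_box_def)

lemma sum_split_subset:
  fixes f :: "'a \<Rightarrow> real"
  assumes "finite A" "B \<subseteq> A"
  shows "sum f A = sum f B + sum f (A - B)"
  using sum.subset_diff[OF assms(2,1), of f] by simp

text \<open>
  Indices in \<open>B\<close> earn at least \<open>\<theta>\<close> per unit of \<open>D\<close>, all others at most \<open>\<theta>\<close>. Moving
  \<open>D\<close>-weight from outside \<open>B\<close> into \<open>B\<close> therefore cannot decrease the \<open>a\<close>-value; this is possible as long as
  \<open>B\<close> has room for the whole weight.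
\<close>
lemma exchange_into:
  fixes a D u :: "'a \<Rightarrow> real"
  assumes fin: "finite A" and B: "B \<subseteq> A" and D: "\<And>s. s \<in> A \<Longrightarrow> 0 \<le> D s"
    and hi: "\<And>s. s \<in> B \<Longrightarrow> \<theta> * D s \<le> a s"
    and lo: "\<And>s. s \<in> A - B \<Longrightarrow> a s \<le> \<theta> * D s"
    and u: "u \<in> unit_box" and le: "(\<Sum>s\<in>A. D s * u s) \<le> (\<Sum>s\<in>B. D s)"
  obtains w where "w \<in> unit_box" "\<And>s. s \<in> A - B \<Longrightarrow> w s = 0"
    "(\<Sum>s\<in>A. D s * w s) = (\<Sum>s\<in>A. D s * u s)" "(\<Sum>s\<in>A. a s * u s) \<le> (\<Sum>s\<in>A. a s * w s)"
proof -
  define Q where "Q = (\<Sum>s\<in>B. D s * u s)"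
  define N where "N = (\<Sum>s\<in>A-B. D s * u s)"
  define P where "P = (\<Sum>s\<in>B. D s)"
  have e: "(\<Sum>s\<in>A. D s * u s) = Q + N"
    unfolding Q_def N_def by (rule sum_split_subset[OF fin B])
  have N0: "0 \<le> N" unfolding N_def
    by (intro sum_nonneg mult_nonneg_nonneg) (use D u in \<open>auto dest: unit_boxD\<close>)
  have QP: "Q + N \<le> P" using le e P_def by simp
  \<comment> \<open>\<open>\<nu>\<close> is the fraction of the free room \<open>P - Q\<close> of \<open>B\<close> that takes in the outside weight \<open>N\<close>.\<close>
  define \<nu> where "\<nu> = (if N = 0 then 0 else N / (P - Q))"
  have \<nu>: "0 \<le> \<nu>" "\<nu> \<le> 1" and \<nu>N: "\<nu> * (P - Q) = N"
    using N0 QP by (auto simp: \<nu>_def field_simps)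
  define w where "w = (\<lambda>s. if s \<in> B then u s + \<nu> * (1 - u s) else 0)"
  have "u s + \<nu> * (1 - u s) \<le> u s + 1 * (1 - u s)" for s
    using \<nu> unit_boxD[OF u, of s] by (intro add_left_mono mult_right_mono) auto
  then have wbox: "w \<in> unit_box"
    using \<nu> unit_boxD[OF u] by (auto simp: unit_box_def w_def)
  have wA: "(\<Sum>s\<in>A. g s * w s) = (\<Sum>s\<in>B. g s * u s) + \<nu> * (\<Sum>s\<in>B. g s * (1 - u s))" for g
  proof -
    have "(\<Sum>s\<in>A. g s * w s) = (\<Sum>s\<in>B. g s * w s) + (\<Sum>s\<in>A-B. g s * w s)"
      by (rule sum_split_subset[OF fin B])
    also have "(\<Sum>s\<in>A-B. g s * w s) = 0" by (rule sum.neutral) (simp add: w_def)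
    finally show ?thesis
      by (simp add: w_def distrib_left sum.distrib sum_distrib_left mult.left_commute)
  qed
  have PQ: "(\<Sum>s\<in>B. D s * (1 - u s)) = P - Q"
    by (simp add: P_def Q_def right_diff_distrib sum_subtractf)
  have "(\<Sum>s\<in>A - B. a s * u s) \<le> (\<Sum>s\<in>A - B. (\<theta> * D s) * u s)"
    by (intro sum_mono mult_right_mono lo) (use u in \<open>auto dest: unit_boxD\<close>)
  also have "\<dots> = \<theta> * N" by (simp add: N_def sum_distrib_left mult.assoc)
  also have "\<dots> = \<nu> * (\<Sum>s\<in>B. (\<theta> * D s) * (1 - u s))"
    using PQ \<nu>N by (simp add: mult.assoc flip: sum_distrib_left)
  also have "\<dots> \<le> \<nu> * (\<Sum>s\<in>B. a s * (1 - u s))"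
    by (intro mult_left_mono sum_mono mult_right_mono hi \<nu>) (use u in \<open>auto dest: unit_boxD\<close>)
  finally have "(\<Sum>s\<in>A. a s * u s) \<le> (\<Sum>s\<in>A. a s * w s)"
    using wA[of a] sum_split_subset[OF fin B, of "\<lambda>s. a s * u s"] by simp
  moreover have "(\<Sum>s\<in>A. D s * w s) = (\<Sum>s\<in>A. D s * u s)"
    using wA[of D] PQ \<nu>N e by (simp add: Q_def)
  moreover have "\<And>s. s \<in> A - B \<Longrightarrow> w s = 0" by (simp add: w_def)
  ultimately show thesis using wbox that by blast
qed

text \<open>
  The mirror image of \<open>exchange_into\<close> under \<open>u \<mapsto> 1 - u\<close>: when the weight exceeds what \<open>B\<close> can hold, \<open>B\<close> may be
  assumed full.
\<close>
lemma exchange_filling: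
  fixes a D u :: "'a \<Rightarrow> real"
  assumes fin: "finite A" and B: "B \<subseteq> A" and D: "\<And>s. s \<in> A \<Longrightarrow> 0 \<le> D s"
    and hi: "\<And>s. s \<in> B \<Longrightarrow> \<theta> * D s \<le> a s"
    and lo: "\<And>s. s \<in> A - B \<Longrightarrow> a s \<le> \<theta> * D s"
    and u: "u \<in> unit_box" and ge: "(\<Sum>s\<in>B. D s) \<le> (\<Sum>s\<in>A. D s * u s)"
  obtains w where "w \<in> unit_box" "\<And>s. s \<in> B \<Longrightarrow> w s = 1"
    "(\<Sum>s\<in>A. D s * w s) = (\<Sum>s\<in>A. D s * u s)" "(\<Sum>s\<in>A. a s * u s) \<le> (\<Sum>s\<in>A. a s * w s)"
proof -
  have cmp: "(\<Sum>s\<in>A. g s * (1 - v s)) = (\<Sum>s\<in>A. g s) - (\<Sum>s\<in>A. g s * v s)" for g v :: "'a \<Rightarrow> real"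
    by (simp add: right_diff_distrib sum_subtractf)
  have split: "sum D A = sum D B + sum D (A - B)" by (rule sum_split_subset[OF fin B])
  obtain w where w: "w \<in> unit_box" "\<And>s. s \<in> A - (A - B) \<Longrightarrow> w s = 0"
    "(\<Sum>s\<in>A. D s * w s) = (\<Sum>s\<in>A. D s * (1 - u s))"
    "(\<Sum>s\<in>A. - a s * (1 - u s)) \<le> (\<Sum>s\<in>A. - a s * w s)"
    by (rule exchange_into[of A "A - B" D "-\<theta>" "\<lambda>s. - a s" "\<lambda>s. 1 - u s"])
      (use fin B D hi lo ge split cmp[of D u] unit_box_complement[OF u] in auto)
  show thesis
  proof (rule that)
    show "(\<lambda>s. 1 - w s) \<in> unit_box" by (rule unit_box_complement[OF w(1)])
    show "\<And>s. s \<in> B \<Longrightarrow> 1 - w s = 1" using w(2) B by auto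
    show "(\<Sum>s\<in>A. D s * (1 - w s)) = (\<Sum>s\<in>A. D s * u s)"
      using w(3) by (simp add: cmp)
    show "(\<Sum>s\<in>A. a s * u s) \<le> (\<Sum>s\<in>A. a s * (1 - w s))"
      using w(4) cmp[of "\<lambda>s. - a s" u] cmp[of a w] by (simp add: sum_negf)
  qed
qed

section \<open>Absorbing demand into an order\<close>

text \<open>
  Trimming every \<open>D s\<close> to \<open>min (D s) (\<tau> * a s)\<close> raises all ratios \<open>a s / D' s\<close> to at least \<open>\<kappa> = 1 / \<tau>\<close>, with
  equality on the set \<open>B\<close> of trimmed indices. The total amount trimmed varies continuously with \<open>\<tau>\<close>, so it can be made
  equal to \<open>X\<close>. Indices with \<open>a s = 0\<close> would be trimmed away completely for every \<open>\<tau>\<close>; if they alone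
  suffice for \<open>X\<close>, the level is \<open>\<kappa> = 0\<close> and they are trimmed proportionally.
\<close>
lemma water_level:
  fixes a D :: "'a \<Rightarrow> real"
  assumes fin: "finite A" and D: "\<And>s. s \<in> A \<Longrightarrow> 0 \<le> D s" and a: "\<And>s. s \<in> A \<Longrightarrow> 0 \<le> a s"
    and X: "0 \<le> X" "X < (\<Sum>s\<in>A. D s)"
  obtains \<kappa> B D' where "0 \<le> \<kappa>" "B \<subseteq> A" "\<And>s. s \<in> A \<Longrightarrow> 0 \<le> D' s \<and> D' s \<le> D s"
    "\<And>s. s \<in> B \<Longrightarrow> a s = \<kappa> * D' s" "\<And>s. s \<in> A - B \<Longrightarrow> D' s = D s"
    "\<And>s. s \<in> A - B \<Longrightarrow> \<kappa> * D s \<le> a s" "(\<Sum>s\<in>B. D s - D' s) = X"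
proof (cases "X \<le> (\<Sum>s\<in>{s\<in>A. a s = 0}. D s)")
  case True
  let ?B = "{s\<in>A. a s = 0}"
  define r where "r = (if X = 0 then 0 else X / (\<Sum>s\<in>?B. D s))"
  have r: "0 \<le> r" "r \<le> 1" "r * (\<Sum>s\<in>?B. D s) = X"
    using X True by (auto simp: r_def field_simps)
  define D' where "D' = (\<lambda>s. if a s = 0 then (1 - r) * D s else D s)"
  show thesis
  proof (rule that[of 0 ?B D'])
    show "0 \<le> D' s \<and> D' s \<le> D s" if "s \<in> A" for s
      using r D[OF that] by (auto simp: D'_def mult_left_le_one_le)
    have "(\<Sum>s\<in>?B. D s - D' s) = (\<Sum>s\<in>?B. r * D s)"
      by (rule sum.cong) (auto simp: D'_def algebra_simps)
    also have "\<dots> = X" using r(3) by (simp add: sum_distrib_left)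
    finally show "(\<Sum>s\<in>?B. D s - D' s) = X" .
  qed (use a in \<open>auto simp: D'_def\<close>)
next
  case False
  define g where "g = (\<lambda>\<tau>. \<Sum>s\<in>A. min (D s) (\<tau> * a s))"
  define \<tau>1 where "\<tau>1 = (\<Sum>s\<in>A. D s / a s)"
  have \<tau>1: "D s \<le> \<tau>1 * a s" if "s \<in> A" "a s \<noteq> 0" for s
  proof -
    have "D s / a s \<le> \<tau>1" unfolding \<tau>1_def
      by (rule member_le_sum) (use fin a D that in auto)
    then show ?thesis using that a[OF that(1)] by (simp add: field_simps)
  qed
  have "g \<tau>1 = (\<Sum>s\<in>A. if a s = 0 then 0 else D s)" unfolding g_def
    by (rule sum.cong) (auto dest: \<tau>1 D)
  also have "\<dots> = (\<Sum>s\<in>A. D s) - (\<Sum>s\<in>{s\<in>A. a s = 0}. D s)"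
  proof -
    have "(\<Sum>s\<in>A. D s) = (\<Sum>s\<in>A. (if a s = 0 then 0 else D s) + (if a s = 0 then D s else 0))"
      by (rule sum.cong) auto
    also have "\<dots> = (\<Sum>s\<in>A. if a s = 0 then 0 else D s) + (\<Sum>s\<in>{s\<in>A. a s = 0}. D s)"
      using fin by (simp add: sum.distrib sum.inter_filter)
    finally show ?thesis by simp
  qed
  finally have g1: "(\<Sum>s\<in>A. D s) - X \<le> g \<tau>1" using False by simp
  have g0: "g 0 = 0" unfolding g_def by (rule sum.neutral) (use D in auto)
  have "0 \<le> \<tau>1" unfolding \<tau>1_def by (rule sum_nonneg) (use a D in auto)
  then obtain \<tau> where \<tau>: "0 \<le> \<tau>" "g \<tau> = (\<Sum>s\<in>A. D s) - X"
    using IVT'[of g 0 "(\<Sum>s\<in>A. D s) - X" \<tau>1] g0 g1 X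
    by (force simp: g_def intro!: continuous_intros)
  with g0 X have "\<tau> > 0" by (cases "\<tau> = 0") auto
  define D' where "D' = (\<lambda>s. min (D s) (\<tau> * a s))"
  let ?B = "{s\<in>A. \<tau> * a s \<le> D s}"
  show thesis
  proof (rule that[of "1/\<tau>" ?B D'])
    show "0 \<le> D' s \<and> D' s \<le> D s" if "s \<in> A" for s
      using D[OF that] a[OF that] \<tau> by (auto simp: D'_def)
    have "(\<Sum>s\<in>A. D s - D' s) = X" using \<tau>(2) by (simp add: g_def D'_def sum_subtractf)
    moreover have "(\<Sum>s\<in>A - ?B. D s - D' s) = 0"
      by (rule sum.neutral) (auto simp: D'_def)
    ultimately show "(\<Sum>s\<in>?B. D s - D' s) = X"
      using sum_split_subset[of A ?B "\<lambda>s. D s - D' s"] fin by auto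
  qed (use \<open>\<tau> > 0\<close> in \<open>auto simp: D'_def field_simps\<close>)
qed

lemma convex_on_interval_bound:
  fixes f :: "real \<Rightarrow> real"
  assumes f: "convex_on UNIV f" and "l \<le> x" "x \<le> r"
    and l: "f l - k * l \<le> V" and r: "f r - k * r \<le> V"
  shows "f x - k * x \<le> V"
proof (cases "l = r")
  case True then show ?thesis using assms by simp
next
  case False
  define t where "t = (x - l) / (r - l)"
  have t: "0 \<le> t" "t \<le> 1" and tx: "t * (r - l) = x - l"
    using assms(2,3) False by (auto simp: t_def)
  then have x: "x = (1 - t) * l + t * r" by (simp add: algebra_simps)
  have "f x \<le> (1 - t) * f l + t * f r"
    using convex_onD[OF f t(1,2), of l r] x by simp
  also have "\<dots> \<le> (1 - t) * (V + k * l) + t * (V + k * r)"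
    using t l r by (intro add_mono mult_left_mono) auto
  also have "\<dots> = V + k * x" by (simp add: x algebra_simps)
  finally show ?thesis by simp
qed

text \<open>
  One side of the order problem. Starting at a scenario in which the stock after ordering is \<open>y0\<close> and the
  order is \<open>X\<close>, the adversary can raise the stock: changing index \<open>s\<close> by the fraction \<open>w s\<close> gains
  \<open>D s * w s\<close> and costs \<open>a s * w s\<close>. If the order withdraws \<open>D s - D' s\<close> in response to index \<open>s\<close>, only
  \<open>D' s * w s\<close> is gained; the variable \<open>n\<close> collects the effect of indices that push the stock the other way.
  The hypothesis \<open>bound\<close> concerns the scenarios whose stock is at least \<open>S\<close> even after the whole of \<open>X\<close> has been withdrawn.

  If \<open>X\<close> covers the sum of all \<open>D s\<close>, the order can undo every rise. Otherwise take \<open>D'\<close> from \<open>water_level\<close> and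
  let \<open>P\<close> be the weight of the trimmed indices. Moving by
  \<open>m \<le> P\<close> costs at least \<open>\<kappa> * m\<close>, and the bound holds at \<open>m = 0\<close> and at \<open>m = P\<close>, hence in between by
  convexity of \<open>H\<close>. For \<open>m > P\<close> all trimmed indices may be assumed exhausted; then exactly \<open>X\<close> has been withdrawn,
  and \<open>bound\<close> applies.
\<close>
lemma absorb:
  fixes a D :: "'a \<Rightarrow> real" and H :: "real \<Rightarrow> real"
  assumes fin: "finite A" and D: "\<And>s. s \<in> A \<Longrightarrow> 0 \<le> D s" and a: "\<And>s. s \<in> A \<Longrightarrow> 0 \<le> a s"
    and X: "0 \<le> X" and H: "convex_on UNIV H" and y0: "H y0 \<le> V"
    and bound: "\<And>w. w \<in> unit_box \<Longrightarrow> S \<le> y0 - X + (\<Sum>s\<in>A. D s * w s) \<Longrightarrow>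
      H (y0 - X + (\<Sum>s\<in>A. D s * w s)) - (\<Sum>s\<in>A. a s * w s) \<le> V"
  obtains D' where "\<And>s. s \<in> A \<Longrightarrow> 0 \<le> D' s \<and> D' s \<le> D s" "(\<Sum>s\<in>A. D s - D' s) \<le> X"
    "\<And>w n. w \<in> unit_box \<Longrightarrow> 0 \<le> n \<Longrightarrow> S \<le> y0 + (\<Sum>s\<in>A. D' s * w s) - n \<Longrightarrow>
      y0 \<le> y0 + (\<Sum>s\<in>A. D' s * w s) - n \<Longrightarrow>
      H (y0 + (\<Sum>s\<in>A. D' s * w s) - n) - (\<Sum>s\<in>A. a s * w s) \<le> V"
proof (cases "X < (\<Sum>s\<in>A. D s)")
  case False
  show thesis
  proof (rule that[of "\<lambda>_. 0"])
    fix w :: "'a \<Rightarrow> real" and n :: real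
    assume w: "w \<in> unit_box" and n: "0 \<le> n" "y0 \<le> y0 + (\<Sum>s\<in>A. 0 * w s) - n"
    have "0 \<le> (\<Sum>s\<in>A. a s * w s)"
      by (intro sum_nonneg mult_nonneg_nonneg a) (use w in \<open>auto dest: unit_boxD\<close>)
    with y0 n show "H (y0 + (\<Sum>s\<in>A. 0 * w s) - n) - (\<Sum>s\<in>A. a s * w s) \<le> V"
      by simp
  qed (use D False in auto)
next
  case True
  obtain \<kappa> B D' where \<kappa>: "0 \<le> \<kappa>" and B: "B \<subseteq> A"
    and D': "\<And>s. s \<in> A \<Longrightarrow> 0 \<le> D' s \<and> D' s \<le> D s"
    and aB: "\<And>s. s \<in> B \<Longrightarrow> a s = \<kappa> * D' s" and DnB: "\<And>s. s \<in> A - B \<Longrightarrow> D' s = D s"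
    and anB: "\<And>s. s \<in> A - B \<Longrightarrow> \<kappa> * D s \<le> a s" and XB: "(\<Sum>s\<in>B. D s - D' s) = X"
    by (rule water_level[OF fin D a X True], assumption, assumption, (rule that; assumption))
  have DD: "(\<Sum>s\<in>A. D s * w s) = X + (\<Sum>s\<in>A. D' s * w s)" if "\<And>s. s \<in> B \<Longrightarrow> w s = 1" for w
  proof -
    have "(\<Sum>s\<in>A. (D s - D' s) * w s) = (\<Sum>s\<in>B. (D s - D' s) * w s) + (\<Sum>s\<in>A-B. (D s - D' s) * w s)"
      by (rule sum_split_subset[OF fin B])
    also have "\<dots> = X" using XB that DnB by simp
    finally show ?thesis by (simp add: left_diff_distrib sum_subtractf)
  qed
  show thesis
  proof (rule that[of D'])
    have "(\<Sum>s\<in>A. D s - D' s) = (\<Sum>s\<in>B. D s - D' s) + (\<Sum>s\<in>A-B. D s - D' s)"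
      by (rule sum_split_subset[OF fin B])
    also have "\<dots> = X" using XB DnB by simp
    finally show "(\<Sum>s\<in>A. D s - D' s) \<le> X" by simp
    fix w :: "'a \<Rightarrow> real" and n :: real
    assume w: "w \<in> unit_box" and n: "0 \<le> n" and S: "S \<le> y0 + (\<Sum>s\<in>A. D' s * w s) - n"
      and y: "y0 \<le> y0 + (\<Sum>s\<in>A. D' s * w s) - n"
    \<comment> \<open>Shrinking \<open>w\<close> proportionally reaches the same stock without \<open>n\<close>, at no higher price.\<close>
    define R where "R = (\<Sum>s\<in>A. D' s * w s)"
    define m where "m = R - n"
    have m: "0 \<le> m" "m \<le> R" using y n by (auto simp: m_def R_def)
    define r where "r = (if R = 0 then 0 else m / R)"
    have r: "0 \<le> r" "r \<le> 1" "r * R = m" using m by (auto simp: r_def field_simps)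
    define v where "v = (\<lambda>s. r * w s)"
    have v: "v \<in> unit_box" unfolding v_def by (rule unit_box_scale[OF w r(1,2)])
    have vm: "(\<Sum>s\<in>A. D' s * v s) = m"
      using r(3) by (simp add: v_def R_def sum_distrib_left mult_ac)
    have av: "(\<Sum>s\<in>A. a s * v s) \<le> (\<Sum>s\<in>A. a s * w s)"
      unfolding v_def
      by (intro sum_mono mult_left_mono a) (use r unit_boxD[OF w] in \<open>auto simp: mult_left_le_one_le\<close>)
    define P where "P = (\<Sum>s\<in>B. D' s)"
    have "H (y0 + m) - (\<Sum>s\<in>A. a s * v s) \<le> V"
    proof (cases "m \<le> P")
      case True
      let ?w = "\<lambda>s. if s \<in> B then 1 else 0 :: real"
      have ind: "(\<Sum>s\<in>A. g s * ?w s) = (\<Sum>s\<in>B. g s)" for g :: "'a \<Rightarrow> real"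
        using B fin by (simp add: if_distrib sum.If_cases Int_absorb1 cong: if_cong)
      have "(\<Sum>s\<in>A. D s * ?w s) = X + P" using DD[of ?w] ind[of D'] by (simp add: P_def)
      moreover have "(\<Sum>s\<in>A. a s * ?w s) = \<kappa> * P"
        using aB by (simp add: ind P_def sum_distrib_left)
      ultimately have HP: "H (y0 + P) - \<kappa> * P \<le> V"
        using bound[of ?w] unit_box_indicator[of "\<lambda>s. s \<in> B"] S True by (simp add: m_def R_def)
      have "H (y0 + m) - \<kappa> * (y0 + m) \<le> V - \<kappa> * y0"
        by (rule convex_on_interval_bound[OF H, of y0 "y0 + m" "y0 + P" \<kappa> "V - \<kappa> * y0"])
          (use HP y0 m True in \<open>auto simp: algebra_simps\<close>)
      moreover have "\<kappa> * m \<le> (\<Sum>s\<in>A. a s * v s)"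
        unfolding vm[symmetric] sum_distrib_left mult.assoc[symmetric]
      proof (intro sum_mono mult_right_mono)
        show "\<kappa> * D' s \<le> a s" if "s \<in> A" for s using that aB[of s] anB[of s] DnB[of s] by (cases "s \<in> B") auto
      qed (use v in \<open>auto dest: unit_boxD\<close>)
      ultimately show ?thesis by (simp add: algebra_simps)
    next
      case False
      obtain z where z: "z \<in> unit_box" "\<And>s. s \<in> B \<Longrightarrow> z s = 1"
        "(\<Sum>s\<in>A. D' s * z s) = (\<Sum>s\<in>A. D' s * v s)"
        "(\<Sum>s\<in>A. - a s * v s) \<le> (\<Sum>s\<in>A. - a s * z s)"
        by (rule exchange_filling[OF fin B, of D' "-\<kappa>" "\<lambda>s. - a s" v])
          (use D' aB anB DnB v vm False in \<open>auto simp: P_def\<close>)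
      have "(\<Sum>s\<in>A. D s * z s) = X + m" using DD[of z] z vm by simp
      then have "H (y0 + m) - (\<Sum>s\<in>A. a s * z s) \<le> V"
        using bound[of z] z S by (simp add: m_def R_def)
      with z(4) show ?thesis by (simp add: sum_negf)
    qed
    with av show "H (y0 + (\<Sum>s\<in>A. D' s * w s) - n) - (\<Sum>s\<in>A. a s * w s) \<le> V"
      by (simp add: m_def R_def add_diff_eq)
  qed (use D' in auto)
qed

lemma convex_on_toward_minimum:
  fixes H :: "real \<Rightarrow> real"
  assumes H: "convex_on UNIV H" and min: "H S \<le> H z" and "S \<le> y \<and> y \<le> z \<or> z \<le> y \<and> y \<le> S"
  shows "H y \<le> H z"
  using convex_on_interval_bound[OF H, of S y z 0 "H z"] convex_on_interval_bound[OF H, of z y S 0 "H z"]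
    assms(3) min by auto

lemma convex_on_reflect:
  fixes H :: "real \<Rightarrow> real"
  assumes H: "convex_on UNIV H"
  shows "convex_on UNIV (\<lambda>y. H (- y))"
proof (rule convex_onI)
  fix t x y :: real
  assume "0 < t" "t < 1"
  then show "H (- ((1 - t) *\<^sub>R x + t *\<^sub>R y)) \<le> (1 - t) * H (- x) + t * H (- y)"
    using convex_onD[OF H, of t "- x" "- y"] by simp
qed auto

lemma convex_on_UNIV_continuous:
  fixes H :: "real \<Rightarrow> real"
  assumes "convex_on UNIV H"
  shows "continuous_on A H"
  by (rule continuous_on_subset[OF convex_on_continuous[OF open_UNIV assms]]) simp

text \<open>
  An affine order can replace one that depends arbitrarily on the scenario. The affine cost is largest at the indicator of \<open>P\<close>, the set of indices with \<open>a s > 0\<close>. There the order \<open>X\<close> brings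
  the stock as close to a minimiser \<open>S\<close> of \<open>H\<close> as the capacity permits. Leaving that scenario costs the
  adversary money, either by lowering coordinates in \<open>P\<close>, which raises the stock, or by raising coordinates outside
  \<open>P\<close>, which lowers it. The order may shrink by \<open>X\<close> on the first side and grow by \<open>p - X\<close> on the second;
  \<open>absorb\<close> distributes both amounts, the second time after reflecting the stock axis.
  That the coefficients lie between \<open>0\<close> and \<open>D\<close> keeps the stock nonincreasing in each coordinate, as the next period needs.
\<close>
lemma order_step_free:
  fixes a D :: "'a \<Rightarrow> real" and H :: "real \<Rightarrow> real"
  assumes fin: "finite A" and D: "\<And>s. s \<in> A \<Longrightarrow> 0 \<le> D s" and p: "0 \<le> p"
    and H: "convex_on UNIV H"
    and bound: "\<And>u. u \<in> unit_box \<Longrightarrow>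
      \<exists>x\<in>{0..p}. \<alpha> + (\<Sum>s\<in>A. a s * u s) + H (\<beta> - (\<Sum>s\<in>A. D s * u s) + x) \<le> V"
  obtains x0 x where "0 \<le> x0" "\<And>s. s \<in> A \<Longrightarrow> 0 \<le> x s \<and> x s \<le> D s" "x0 + (\<Sum>s\<in>A. x s) \<le> p"
    "\<And>u. u \<in> unit_box \<Longrightarrow> \<alpha> + (\<Sum>s\<in>A. a s * u s)
       + H (\<beta> - (\<Sum>s\<in>A. D s * u s) + (x0 + (\<Sum>s\<in>A. x s * u s))) \<le> V"
proof -
  define P where "P = {s\<in>A. a s > 0}"
  define N where "N = A - P"
  have PA: "P \<subseteq> A" and NA: "N \<subseteq> A" and finP: "finite P" and finN: "finite N"
    using fin by (auto simp: P_def N_def)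
  have split: "sum g A = sum g P + sum g N" for g :: "'a \<Rightarrow> real"
    unfolding N_def by (rule sum_split_subset[OF fin PA])
  have aP: "0 \<le> a s" if "s \<in> P" for s using that by (simp add: P_def)
  have aN: "a s \<le> 0" if "s \<in> N" for s using that by (auto simp: P_def N_def)
  define L where "L = \<beta> - sum D A"
  have LU: "L \<le> \<beta> + p" using p sum_nonneg[of A D] D by (simp add: L_def)
  have "compact {L..\<beta>+p}" "{L..\<beta>+p} \<noteq> {}" using LU by auto
  from continuous_attains_inf[OF this convex_on_UNIV_continuous[OF H]]
  obtain S where S: "S \<in> {L..\<beta>+p}" "\<And>z. z \<in> {L..\<beta>+p} \<Longrightarrow> H S \<le> H z" by blast
  have toS: "H y \<le> H z" if "z \<in> {L..\<beta>+p}" "S \<le> y \<and> y \<le> z \<or> z \<le> y \<and> y \<le> S" for y z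
    using convex_on_toward_minimum[OF H S(2)[OF that(1)] that(2)] .
  have rng: "\<beta> - (\<Sum>s\<in>A. D s * u s) + x \<in> {L..\<beta>+p}" if "u \<in> unit_box" "x \<in> {0..p}" for u x
  proof -
    have "0 \<le> (\<Sum>s\<in>A. D s * u s)"
      by (intro sum_nonneg mult_nonneg_nonneg D) (use that in \<open>auto dest: unit_boxD\<close>)
    moreover have "(\<Sum>s\<in>A. D s * u s) \<le> sum D A"
      by (intro sum_mono mult_left_le D) (use that in \<open>auto dest: unit_boxD\<close>)
    ultimately show ?thesis using that(2) by (simp add: L_def)
  qed
  define I0 where "I0 = \<beta> - sum D P"
  define A0 where "A0 = \<alpha> + sum a P"
  define X where "X = max 0 (min p (S - I0))"
  have X: "0 \<le> X" "X \<le> p" using p by (auto simp: X_def)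
  define y0 where "y0 = I0 + X"
  have mix: "(\<Sum>s\<in>A. g s * (if s \<in> P then v s else w s)) = (\<Sum>s\<in>P. g s * v s) + (\<Sum>s\<in>N. g s * w s)"
    for g v w :: "'a \<Rightarrow> real"
    unfolding split using N_def by (intro arg_cong2[where f="(+)"] sum.cong) auto
  have mixbox: "(\<lambda>s. if s \<in> P then v s else w s) \<in> unit_box" if "v \<in> unit_box" "w \<in> unit_box"
    for v w :: "'a \<Rightarrow> real" using that by (auto simp: unit_box_def)
  have const: "(\<lambda>_. 1) \<in> (unit_box :: ('a \<Rightarrow> real) set)" "(\<lambda>_. 0) \<in> (unit_box :: ('a \<Rightarrow> real) set)"
    by (auto simp: unit_box_def)
  have y0: "A0 + H y0 \<le> V"
  proof -
    let ?u = "\<lambda>s. if s \<in> P then 1 else 0 :: real"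
    have u: "?u \<in> unit_box" by (rule mixbox[OF const])
    from bound[OF u] obtain x where x: "x \<in> {0..p}" and le: "A0 + H (I0 + x) \<le> V"
      using mix[of a "\<lambda>_. 1" "\<lambda>_. 0"] mix[of D "\<lambda>_. 1" "\<lambda>_. 0"] by (auto simp: A0_def I0_def)
    have "I0 + x \<in> {L..\<beta>+p}"
      using rng[OF u x] mix[of D "\<lambda>_. 1" "\<lambda>_. 0"] by (simp add: I0_def)
    moreover have "S \<le> y0 \<and> y0 \<le> I0 + x \<or> I0 + x \<le> y0 \<and> y0 \<le> S \<or> y0 = S"
      using x by (auto simp: y0_def X_def)
    ultimately have "H y0 \<le> H (I0 + x)" using toS S(2) by blast
    with le show ?thesis by simp
  qed
  obtain E where E: "\<And>s. s \<in> P \<Longrightarrow> 0 \<le> E s \<and> E s \<le> D s" "(\<Sum>s\<in>P. D s - E s) \<le> X"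
    and Eb: "\<And>w n. w \<in> unit_box \<Longrightarrow> 0 \<le> n \<Longrightarrow> S \<le> y0 + (\<Sum>s\<in>P. E s * w s) - n \<Longrightarrow>
      y0 \<le> y0 + (\<Sum>s\<in>P. E s * w s) - n \<Longrightarrow>
      H (y0 + (\<Sum>s\<in>P. E s * w s) - n) - (\<Sum>s\<in>P. a s * w s) \<le> V - A0"
  proof (rule absorb[of P D a X H y0 "V - A0" S])
    show "0 \<le> D s" "0 \<le> a s" if "s \<in> P" for s using that D aP PA by auto
    fix w :: "'a \<Rightarrow> real"
    assume w: "w \<in> unit_box" and Sw: "S \<le> y0 - X + (\<Sum>s\<in>P. D s * w s)"
    let ?u = "\<lambda>s. if s \<in> P then 1 - w s else 0 :: real"
    have u: "?u \<in> unit_box" by (rule mixbox[OF unit_box_complement[OF w] const(2)])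
    have m: "(\<Sum>s\<in>A. g s * ?u s) = sum g P - (\<Sum>s\<in>P. g s * w s)" for g
      using mix[of g "\<lambda>s. 1 - w s" "\<lambda>_. 0"] by (simp add: right_diff_distrib sum_subtractf)
    let ?i = "y0 - X + (\<Sum>s\<in>P. D s * w s)"
    have i: "\<beta> - (\<Sum>s\<in>A. D s * ?u s) = ?i" unfolding m by (simp add: y0_def I0_def)
    from bound[OF u, unfolded i, unfolded m] obtain x where x: "x \<in> {0..p}"
      and le: "A0 - (\<Sum>s\<in>P. a s * w s) + H (?i + x) \<le> V"
      by (auto simp: A0_def add_diff_eq)
    have "H ?i \<le> H (?i + x)"
      using rng[OF u x] x Sw unfolding i by (intro toS) auto
    with le show "H ?i - (\<Sum>s\<in>P. a s * w s) \<le> V - A0" by simp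
  qed (use finP X y0 H in auto)
  obtain F where F: "\<And>s. s \<in> N \<Longrightarrow> 0 \<le> F s \<and> F s \<le> D s" "(\<Sum>s\<in>N. D s - F s) \<le> p - X"
    and Fb: "\<And>w n. w \<in> unit_box \<Longrightarrow> 0 \<le> n \<Longrightarrow> - S \<le> - y0 + (\<Sum>s\<in>N. F s * w s) - n \<Longrightarrow>
      - y0 \<le> - y0 + (\<Sum>s\<in>N. F s * w s) - n \<Longrightarrow>
      H (- (- y0 + (\<Sum>s\<in>N. F s * w s) - n)) - (\<Sum>s\<in>N. - a s * w s) \<le> V - A0"
  proof (rule absorb[of N D "\<lambda>s. - a s" "p - X" "\<lambda>y. H (- y)" "- y0" "V - A0" "- S"])
    show "0 \<le> D s" "0 \<le> - a s" if "s \<in> N" for s using that D aN NA by auto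
    fix w :: "'a \<Rightarrow> real"
    assume w: "w \<in> unit_box" and Sw: "- S \<le> - y0 - (p - X) + (\<Sum>s\<in>N. D s * w s)"
    let ?u = "\<lambda>s. if s \<in> P then 1 else w s :: real"
    have u: "?u \<in> unit_box" by (rule mixbox[OF const(1) w])
    have m: "(\<Sum>s\<in>A. g s * ?u s) = sum g P + (\<Sum>s\<in>N. g s * w s)" for g
      using mix[of g "\<lambda>s. 1" w] by simp
    let ?i = "y0 + (p - X) - (\<Sum>s\<in>N. D s * w s)"
    have i: "\<beta> - (\<Sum>s\<in>A. D s * ?u s) = ?i - p" unfolding m by (simp add: y0_def I0_def)
    from bound[OF u, unfolded i, unfolded m] obtain x where x: "x \<in> {0..p}"
      and le: "A0 + (\<Sum>s\<in>N. a s * w s) + H (?i - p + x) \<le> V"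
      by (auto simp: A0_def add_ac)
    have "H ?i \<le> H (?i - p + x)"
      using rng[OF u x] x Sw unfolding i by (intro toS) auto
    moreover have eq: "- (- y0 - (p - X) + (\<Sum>s\<in>N. D s * w s)) = ?i" by simp
    ultimately show "H (- (- y0 - (p - X) + (\<Sum>s\<in>N. D s * w s))) - (\<Sum>s\<in>N. - a s * w s) \<le> V - A0"
      unfolding eq using le by (simp add: sum_negf)
  qed (use finN X y0 convex_on_reflect[OF H] in auto)
  define x where "x = (\<lambda>s. if s \<in> P then D s - E s else D s - F s)"
  define x0 where "x0 = X - (\<Sum>s\<in>P. D s - E s)"
  have xA: "(\<Sum>s\<in>A. x s * u s) = (\<Sum>s\<in>P. (D s - E s) * u s) + (\<Sum>s\<in>N. (D s - F s) * u s)" for u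
    unfolding split using N_def by (intro arg_cong2[where f="(+)"] sum.cong) (auto simp: x_def)
  show thesis
  proof (rule that[of x0 x])
    show "0 \<le> x0" using E(2) by (simp add: x0_def)
    show "0 \<le> x s \<and> x s \<le> D s" if "s \<in> A" for s
      using that E(1)[of s] F(1)[of s] by (auto simp: x_def N_def)
    show "x0 + sum x A \<le> p" using xA[of "\<lambda>_. 1"] F(2) by (simp add: x0_def)
    fix u :: "'a \<Rightarrow> real" assume u: "u \<in> unit_box"
    define w where "w = (\<lambda>s. 1 - u s)"
    have w: "w \<in> unit_box" unfolding w_def by (rule unit_box_complement[OF u])
    define G where "G = (\<Sum>s\<in>P. E s * w s)"
    define K where "K = (\<Sum>s\<in>N. F s * u s)"
    have G0: "0 \<le> G" unfolding G_def
      by (intro sum_nonneg mult_nonneg_nonneg) (use E w in \<open>auto dest: unit_boxD\<close>)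
    have K0: "0 \<le> K" unfolding K_def
      by (intro sum_nonneg mult_nonneg_nonneg) (use F u in \<open>auto dest: unit_boxD\<close>)
    let ?y = "\<beta> - (\<Sum>s\<in>A. D s * u s) + (x0 + (\<Sum>s\<in>A. x s * u s))"
    have y: "?y = y0 + G - K"
      unfolding xA split[of "\<lambda>s. D s * u s"]
      by (simp add: x0_def y0_def I0_def G_def K_def w_def algebra_simps sum_subtractf sum.distrib)
    have cost: "\<alpha> + (\<Sum>s\<in>A. a s * u s) = A0 - (\<Sum>s\<in>P. a s * w s) + (\<Sum>s\<in>N. a s * u s)"
      unfolding split[of "\<lambda>s. a s * u s"] by (simp add: A0_def w_def algebra_simps sum_subtractf)
    have cP: "0 \<le> (\<Sum>s\<in>P. a s * w s)"
      by (intro sum_nonneg mult_nonneg_nonneg aP) (use w in \<open>auto dest: unit_boxD\<close>)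
    have cN: "(\<Sum>s\<in>N. a s * u s) \<le> 0"
      by (intro sum_nonpos mult_nonpos_nonneg aN) (use u in \<open>auto dest: unit_boxD\<close>)
    consider "S \<le> y0 + G - K" "y0 \<le> y0 + G - K" | "y0 + G - K \<le> S" "y0 + G - K \<le> y0"
      | "S \<le> y0 + G - K \<and> y0 + G - K \<le> y0 \<or> y0 \<le> y0 + G - K \<and> y0 + G - K \<le> S" by linarith
    then show "\<alpha> + (\<Sum>s\<in>A. a s * u s) + H ?y \<le> V"
    proof cases
      case 1
      then show ?thesis unfolding y cost using Eb[OF w K0] cN by (simp add: G_def)
    next
      case 2
      then have "H (y0 + G - K) + (\<Sum>s\<in>N. a s * u s) \<le> V - A0"
        using Fb[OF u G0] by (simp add: K_def sum_negf algebra_simps)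
      then show ?thesis unfolding y cost using cP by simp
    next
      case 3
      have "I0 + X \<in> {L..\<beta>+p}"
        using rng[OF mixbox[OF const], of X] mix[of D "\<lambda>_. 1" "\<lambda>_. 0"] X by (simp add: I0_def)
      then have "H (y0 + G - K) \<le> H y0" using 3 by (intro toS) (auto simp: y0_def)
      then show ?thesis unfolding y cost using cP cN y0 by simp
    qed
  qed
qed

section \<open>Bounding a stage cost by an affine function\<close>

text \<open>
  The stage cost \<open>max (h * I) (- b * I)\<close> of the stock \<open>I u = \<beta> - (\<Sum>s\<in>A. D s * u s)\<close> is bounded by an affine function of \<open>u\<close> with
  slopes \<open>- \<gamma> s * D s\<close>. The conditions on \<open>\<gamma>\<close> and \<open>z\<close> make it a bound on the whole box: relative to
  \<open>u = 0\<close> its slopes dominate those of \<open>h * I\<close>, relative to \<open>u = 1\<close> those of \<open>- b * I\<close>.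

  The interesting case is that \<open>I\<close> changes sign. Then \<open>\<gamma> s * D s\<close> is \<open>a s - \<theta> * D s\<close> clamped to
  \<open>[- b * D s, h * D s]\<close>, and \<open>\<theta>\<close> is tuned by continuity until the affine function agrees with \<open>h * I\<close> at
  \<open>u = 0\<close> and with \<open>- b * I\<close> at \<open>u = 1\<close>. The remaining cost slopes \<open>a'\<close> exceed \<open>\<theta> * D\<close> on \<open>Hi\<close>, equal it in the
  middle and stay below it on \<open>Lo\<close>. The scenarios of largest cost for a given stock thus use \<open>Hi\<close> first and
  \<open>Lo\<close> last. While only \<open>Hi\<close> is in use the affine bound equals \<open>h * I\<close>, once only \<open>Lo\<close> is left
  it equals \<open>- b * I\<close>, and in between the cost is linear in the stock, so convexity of \<open>J\<close> applies.
\<close>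
lemma cost_step:
  fixes a D :: "'a \<Rightarrow> real" and J :: "real \<Rightarrow> real"
  assumes fin: "finite A" and D: "\<And>s. s \<in> A \<Longrightarrow> 0 \<le> D s" and h: "0 \<le> h" and b: "0 \<le> b"
    and J: "convex_on UNIV J"
    and bound: "\<And>u. u \<in> unit_box \<Longrightarrow> \<alpha> + (\<Sum>s\<in>A. a s * u s)
      + max (h * (\<beta> - (\<Sum>s\<in>A. D s * u s))) (- b * (\<beta> - (\<Sum>s\<in>A. D s * u s)))
      + J (\<beta> - (\<Sum>s\<in>A. D s * u s)) \<le> V"
  obtains z \<gamma> where "\<And>s. s \<in> A \<Longrightarrow> - b \<le> \<gamma> s \<and> \<gamma> s \<le> h" "h * \<beta> \<le> z"
    "- b * (\<beta> - (\<Sum>s\<in>A. D s)) \<le> z - (\<Sum>s\<in>A. \<gamma> s * D s)"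
    "\<And>u. u \<in> unit_box \<Longrightarrow> \<alpha> + z + (\<Sum>s\<in>A. (a s - \<gamma> s * D s) * u s)
      + J (\<beta> - (\<Sum>s\<in>A. D s * u s)) \<le> V"
proof -
  have pull: "(\<Sum>s\<in>A. (a s - k * D s) * u s) = (\<Sum>s\<in>A. a s * u s) - k * (\<Sum>s\<in>A. D s * u s)" for k u
    by (simp add: algebra_simps sum_subtractf sum_distrib_left)
  consider "sum D A \<le> \<beta>" | "\<beta> \<le> 0" | "0 < \<beta>" "\<beta> < sum D A" by linarith
  then show thesis
  proof cases
    case 1
    show thesis
    proof (rule that[of "\<lambda>_. h" "h * \<beta>"])
      show "- b * (\<beta> - sum D A) \<le> h * \<beta> - (\<Sum>s\<in>A. h * D s)"
        using 1 h b mult_nonneg_nonneg[of "h + b" "\<beta> - sum D A"]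
        by (simp add: algebra_simps flip: sum_distrib_left)
      fix u :: "'a \<Rightarrow> real" assume "u \<in> unit_box"
      from bound[OF this] show "\<alpha> + h * \<beta> + (\<Sum>s\<in>A. (a s - h * D s) * u s)
          + J (\<beta> - (\<Sum>s\<in>A. D s * u s)) \<le> V"
        unfolding pull by (simp add: algebra_simps)
    qed (use h b in auto)
  next
    case 2
    show thesis
    proof (rule that[of "\<lambda>_. - b" "- b * \<beta>"])
      show "h * \<beta> \<le> - b * \<beta>"
        using 2 h b mult_nonneg_nonpos[of "h + b" "\<beta>"] by (simp add: algebra_simps)
      fix u :: "'a \<Rightarrow> real" assume "u \<in> unit_box"
      from bound[OF this] show "\<alpha> + - b * \<beta> + (\<Sum>s\<in>A. (a s - - b * D s) * u s)
          + J (\<beta> - (\<Sum>s\<in>A. D s * u s)) \<le> V"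
        unfolding pull by (simp add: algebra_simps)
    qed (use h b in \<open>auto simp: algebra_simps sum_distrib_left sum_negf\<close>)
  next
    case 3
    define g where "g = (\<lambda>\<theta> s. max (- b * D s) (min (h * D s) (a s - \<theta> * D s)))"
    define K where "K = (\<Sum>s\<in>A. \<bar>a s\<bar> / D s) + h + b"
    have K: "\<bar>a s\<bar> + h * D s \<le> K * D s \<and> \<bar>a s\<bar> + b * D s \<le> K * D s" if "s \<in> A" "D s \<noteq> 0" for s
    proof -
      have "\<bar>a s\<bar> / D s \<le> (\<Sum>s\<in>A. \<bar>a s\<bar> / D s)"
        by (rule member_le_sum) (use fin D that in auto)
      moreover have "D s > 0" using D[OF that(1)] that(2) by simp
      ultimately have "\<bar>a s\<bar> \<le> (\<Sum>s\<in>A. \<bar>a s\<bar> / D s) * D s" by (simp add: field_simps)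
      moreover have "0 \<le> h * D s" "0 \<le> b * D s" using h b D[OF that(1)] by auto
      ultimately show ?thesis by (simp add: K_def distrib_right)
    qed
    have K0: "0 \<le> K" unfolding K_def using h b D by (auto intro!: add_nonneg_nonneg sum_nonneg)
    have glo: "g K s = - b * D s" if "s \<in> A" for s
      using K[OF that] h b D[OF that] unfolding g_def by (cases "D s = 0") auto
    have ghi: "g (- K) s = h * D s" if "s \<in> A" for s
    proof (cases "D s = 0")
      case False
      have "- b * D s \<le> h * D s" using h b D[OF that] by (intro mult_right_mono) auto
      then show ?thesis using K[OF that False] unfolding g_def by auto
    qed (simp add: g_def)
    define W where "W = h * \<beta> + b * (\<beta> - sum D A)"
    have "(\<Sum>s\<in>A. g K s) = - b * sum D A" by (simp add: glo sum_distrib_left sum_negf)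
    moreover have "- b * sum D A \<le> W" using 3 h b by (simp add: W_def algebra_simps)
    moreover have "(\<Sum>s\<in>A. g (-K) s) = h * sum D A" by (simp add: ghi sum_distrib_left)
    moreover have "W \<le> h * sum D A"
      using 3 h b mult_nonneg_nonneg[of "h + b" "sum D A - \<beta>"] by (simp add: W_def algebra_simps)
    ultimately obtain \<theta> where \<theta>: "(\<Sum>s\<in>A. g \<theta> s) = W"
      using IVT2'[of "\<lambda>\<theta>. \<Sum>s\<in>A. g \<theta> s" K W "- K"] K0
      by (force simp: g_def intro!: continuous_intros)
    define \<gamma> where "\<gamma> = (\<lambda>s. if D s = 0 then 0 else g \<theta> s / D s)"
    have \<gamma>D: "\<gamma> s * D s = g \<theta> s" for s by (simp add: \<gamma>_def g_def)
    define a' where "a' = (\<lambda>s. a s - g \<theta> s)"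
    define Hi where "Hi = {s\<in>A. h * D s < a s - \<theta> * D s}"
    define Lo where "Lo = {s\<in>A. a s - \<theta> * D s < - b * D s}"
    have bh: "- b * D s \<le> h * D s" if "s \<in> A" for s
      using h b D[OF that] by (intro mult_right_mono) auto
    have gHi: "g \<theta> s = h * D s" "\<theta> * D s \<le> a' s" if "s \<in> Hi" for s
      using that bh[of s] by (auto simp: Hi_def g_def a'_def)
    have gLo: "g \<theta> s = - b * D s" "a' s \<le> \<theta> * D s" if "s \<in> Lo" for s
      using that bh[of s] by (auto simp: Lo_def g_def a'_def)
    have gMid: "a' s = \<theta> * D s" if "s \<in> A - Hi - Lo" for s
      using that by (auto simp: Lo_def Hi_def g_def a'_def)
    have HiA: "Hi \<subseteq> A" and LoA: "Lo \<subseteq> A" and disj: "Hi \<inter> Lo = {}"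
      using bh by (force simp: Hi_def Lo_def)+
    have box_const: "(\<lambda>s. if s \<in> B then 1 else 0) \<in> (unit_box :: ('a \<Rightarrow> real) set)" for B
      by (rule unit_box_indicator)
    have ind: "(\<Sum>s\<in>A. f s * (if s \<in> B then 1 else 0)) = sum f B" if "B \<subseteq> A" for f :: "'a \<Rightarrow> real" and B
      using that fin by (simp add: if_distrib sum.If_cases Int_absorb1 cong: if_cong)
    define M where "M = A - Lo"
    have MA: "M \<subseteq> A" and HM: "Hi \<subseteq> M" using HiA disj by (auto simp: M_def)
    define val where "val = (\<lambda>u. \<alpha> + h * \<beta> + (\<Sum>s\<in>A. a' s * u s) + J (\<beta> - (\<Sum>s\<in>A. D s * u s)))"
    have val: "val u = \<alpha> + h * \<beta> - (\<Sum>s\<in>A. g \<theta> s * u s) + (\<Sum>s\<in>A. a s * u s) + J (\<beta> - (\<Sum>s\<in>A. D s * u s))" for u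
      by (simp add: val_def a'_def algebra_simps sum_subtractf)
    have on_head: "val u \<le> V" if u: "u \<in> unit_box" and "\<And>s. s \<in> A - Hi \<Longrightarrow> u s = 0" for u
    proof -
      have "(\<Sum>s\<in>A. g \<theta> s * u s) = (\<Sum>s\<in>A. h * (D s * u s))"
        by (rule sum.cong) (use that gHi in auto)
      then have "h * \<beta> - (\<Sum>s\<in>A. g \<theta> s * u s) = h * (\<beta> - (\<Sum>s\<in>A. D s * u s))"
        by (simp add: algebra_simps sum_distrib_left)
      with bound[OF u] show ?thesis unfolding val by linarith
    qed
    have on_tail: "val u \<le> V" if u: "u \<in> unit_box" and "\<And>s. s \<in> M \<Longrightarrow> u s = 1" for u
    proof -
      have "g \<theta> s * (1 - u s) = - b * (D s * (1 - u s))" if "s \<in> A" for s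
        using that \<open>\<And>s. s \<in> M \<Longrightarrow> u s = 1\<close>[of s] gLo(1)[of s] by (cases "s \<in> Lo") (auto simp: M_def)
      then have "(\<Sum>s\<in>A. g \<theta> s * (1 - u s)) = (\<Sum>s\<in>A. - b * (D s * (1 - u s)))"
        by (rule sum.cong[OF refl])
      then have "W - (\<Sum>s\<in>A. g \<theta> s * u s) = - b * (sum D A - (\<Sum>s\<in>A. D s * u s))"
        unfolding \<theta>[symmetric] by (simp add: right_diff_distrib sum_subtractf flip: sum_distrib_left)
      then have "h * \<beta> - (\<Sum>s\<in>A. g \<theta> s * u s) = - b * (\<beta> - (\<Sum>s\<in>A. D s * u s))"
        by (simp add: W_def algebra_simps)
      with bound[OF u] show ?thesis unfolding val by linarith
    qed
    have everywhere: "val u \<le> V" if u: "u \<in> unit_box" for u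
    proof -
      define e where "e = (\<Sum>s\<in>A. D s * u s)"
      consider "e \<le> sum D Hi" | "sum D M \<le> e" | "sum D Hi \<le> e" "e \<le> sum D M" by linarith
      then show ?thesis
      proof cases
        case 1
        obtain w where "w \<in> unit_box" "\<And>s. s \<in> A - Hi \<Longrightarrow> w s = 0"
          "(\<Sum>s\<in>A. D s * w s) = (\<Sum>s\<in>A. D s * u s)" "(\<Sum>s\<in>A. a' s * u s) \<le> (\<Sum>s\<in>A. a' s * w s)"
          by (rule exchange_into[where A = A and B = Hi and D = D and u = u and \<theta> = \<theta> and a = a'])
            (use fin HiA D u gHi gLo gMid 1 in \<open>force simp: e_def\<close>)+
        with on_head[of w] show ?thesis by (simp add: val_def)
      next
        case 2
        obtain w where "w \<in> unit_box" "\<And>s. s \<in> M \<Longrightarrow> w s = 1"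
          "(\<Sum>s\<in>A. D s * w s) = (\<Sum>s\<in>A. D s * u s)" "(\<Sum>s\<in>A. a' s * u s) \<le> (\<Sum>s\<in>A. a' s * w s)"
          by (rule exchange_filling[where A = A and B = M and D = D and u = u and \<theta> = \<theta> and a = a'])
            (use fin MA D u gHi gLo gMid 2 in \<open>force simp: e_def M_def\<close>)+
        with on_tail[of w] show ?thesis by (simp add: val_def)
      next
        case 3
        have "(\<Sum>s\<in>A. (a' s - \<theta> * D s) * u s) \<le> (\<Sum>s\<in>A. (a' s - \<theta> * D s) * (if s \<in> Hi then 1 else 0))"
        proof (rule sum_mono)
          fix s assume "s \<in> A"
          then show "(a' s - \<theta> * D s) * u s \<le> (a' s - \<theta> * D s) * (if s \<in> Hi then 1 else 0)"
            using gHi(2)[of s] gLo(2)[of s] gMid[of s] unit_boxD[OF u, of s]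
            by (cases "s \<in> Hi"; cases "s \<in> Lo") (auto intro: mult_left_le mult_nonpos_nonneg)
        qed
        also have "\<dots> = sum a' Hi - \<theta> * sum D Hi"
          by (simp add: ind[OF HiA] sum_subtractf sum_distrib_left)
        finally have top: "(\<Sum>s\<in>A. a' s * u s) \<le> sum a' Hi + \<theta> * (e - sum D Hi)"
          by (simp add: e_def algebra_simps sum_subtractf sum_distrib_left)
        have "sum a' M - sum a' Hi = (\<Sum>s\<in>M - Hi. a' s)"
          using sum.subset_diff[OF HM finite_subset[OF MA fin], of a'] by simp
        also have "\<dots> = (\<Sum>s\<in>M - Hi. \<theta> * D s)"
          by (rule sum.cong) (use gMid in \<open>auto simp: M_def\<close>)
        also have "\<dots> = \<theta> * (sum D M - sum D Hi)"
          using sum.subset_diff[OF HM finite_subset[OF MA fin], of D] by (simp add: sum_distrib_left)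
        finally have aM: "sum a' M = sum a' Hi + \<theta> * (sum D M - sum D Hi)" by simp
        have r: "\<alpha> + h * \<beta> + sum a' Hi + J (\<beta> - sum D Hi) \<le> V"
          using on_head[OF box_const, of Hi] by (simp add: val_def ind[OF HiA])
        have l: "\<alpha> + h * \<beta> + sum a' M + J (\<beta> - sum D M) \<le> V"
          using on_tail[OF box_const, of M] by (simp add: val_def ind[OF MA])
        have "J (\<beta> - e) - \<theta> * (\<beta> - e)
            \<le> V - \<alpha> - h * \<beta> - sum a' Hi + \<theta> * sum D Hi - \<theta> * \<beta>"
          by (rule convex_on_interval_bound[OF J, of "\<beta> - sum D M" "\<beta> - e" "\<beta> - sum D Hi" \<theta>
              "V - \<alpha> - h * \<beta> - sum a' Hi + \<theta> * sum D Hi - \<theta> * \<beta>"])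
            (use 3 aM l r in \<open>auto simp: algebra_simps\<close>)
        with top show ?thesis by (simp add: val_def e_def algebra_simps)
      qed
    qed
    show thesis
    proof (rule that[of \<gamma> "h * \<beta>"])
      show "- b \<le> \<gamma> s \<and> \<gamma> s \<le> h" if "s \<in> A" for s
      proof (cases "D s = 0")
        case False
        then have "D s > 0" using D[OF that] by simp
        moreover have "- b * D s \<le> g \<theta> s" "g \<theta> s \<le> h * D s" using bh[OF that] by (auto simp: g_def)
        ultimately show ?thesis by (simp add: \<gamma>_def field_simps)
      qed (use h b in \<open>simp add: \<gamma>_def\<close>)
      show "- b * (\<beta> - sum D A) \<le> h * \<beta> - (\<Sum>s\<in>A. \<gamma> s * D s)"
        by (simp add: \<gamma>D \<theta> W_def)
      show "\<alpha> + h * \<beta> + (\<Sum>s\<in>A. (a s - \<gamma> s * D s) * u s) + J (\<beta> - (\<Sum>s\<in>A. D s * u s)) \<le> V"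
        if "u \<in> unit_box" for u
        using everywhere[OF that] by (simp add: \<gamma>D val_def a'_def)
    qed simp
  qed
qed

section \<open>One period of the robust recursion\<close>

lemma convex_on_affine_shift:
  fixes f :: "real \<Rightarrow> real"
  assumes "convex_on UNIV f"
  shows "convex_on UNIV (\<lambda>y. k * y + f (y + d))"
proof (rule convex_onI)
  fix t x y :: real
  assume t: "0 < t" "t < 1"
  have "(1 - t) * x + t * y + d = (1 - t) * (x + d) + t * (y + d)"
    by (simp add: algebra_simps)
  then show "k * ((1 - t) *\<^sub>R x + t *\<^sub>R y) + f ((1 - t) *\<^sub>R x + t *\<^sub>R y + d)
      \<le> (1 - t) * (k * x + f (x + d)) + t * (k * y + f (y + d))"
    using convex_onD[OF assms, of t "x + d" "y + d"] t by (simp add: algebra_simps)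
qed simp

lemma convex_on_max:
  fixes f g :: "real \<Rightarrow> real"
  assumes f: "convex_on UNIV f" and g: "convex_on UNIV g"
  shows "convex_on UNIV (\<lambda>y. max (f y) (g y))"
proof (rule convex_onI)
  fix t x y :: real
  assume t: "0 < t" "t < 1"
  have m: "(1 - t) * f x + t * f y \<le> (1 - t) * max (f x) (g x) + t * max (f y) (g y)"
    "(1 - t) * g x + t * g y \<le> (1 - t) * max (f x) (g x) + t * max (f y) (g y)"
    using t by (intro add_mono mult_left_mono; simp)+
  show "max (f ((1 - t) *\<^sub>R x + t *\<^sub>R y)) (g ((1 - t) *\<^sub>R x + t *\<^sub>R y))
      \<le> (1 - t) * max (f x) (g x) + t * max (f y) (g y)"
    using convex_onD[OF f, of t x y] convex_onD[OF g, of t x y] m t by simp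
qed simp

definition stage_cost :: "real \<Rightarrow> real \<Rightarrow> real \<Rightarrow> real" where
  "stage_cost h b i = max (h * i) (- b * i)"

lemma convex_on_stage_cost: "convex_on UNIV (stage_cost h b)"
proof -
  have "convex_on UNIV (\<lambda>y::real. 0)" by (rule convex_onI) auto
  from convex_on_affine_shift[OF this] have "convex_on UNIV (\<lambda>y::real. k * y)" for k
    by simp
  then show ?thesis unfolding stage_cost_def by (intro convex_on_max)
qed

text \<open>
  A convex function on an interval is largest at an endpoint, so the supremum over a demand interval may be
  replaced by this maximum of two values.
\<close>
definition worst_of_two :: "(real \<Rightarrow> real) \<Rightarrow> real \<Rightarrow> real \<Rightarrow> real \<Rightarrow> real" where
  "worst_of_two F lo hi y = max (F (y - lo)) (F (y - hi))"

lemma convex_on_worst_of_two: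
  assumes "convex_on UNIV F"
  shows "convex_on UNIV (worst_of_two F lo hi)"
  unfolding worst_of_two_def
  using convex_on_max[OF convex_on_affine_shift[OF assms, of 0 "- lo"] convex_on_affine_shift[OF assms, of 0 "- hi"]]
  by simp

lemma worst_of_two_interval:
  assumes "convex_on UNIV F" "0 \<le> r" "r \<le> 1"
  shows "F (y - lo - r * g) \<le> worst_of_two F lo (lo + g) y"
proof -
  have "F ((1 - r) * (y - lo) + r * (y - (lo + g))) \<le> (1 - r) * F (y - lo) + r * F (y - (lo + g))"
    using convex_onD[OF assms, of "y - lo" "y - (lo + g)"] by simp
  also have "\<dots> \<le> (1 - r) * worst_of_two F lo (lo + g) y + r * worst_of_two F lo (lo + g) y"
    using assms by (intro add_mono mult_left_mono) (auto simp: worst_of_two_def)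
  finally show ?thesis by (simp add: algebra_simps)
qed

definition order_value :: "real \<Rightarrow> real \<Rightarrow> (real \<Rightarrow> real) \<Rightarrow> real \<Rightarrow> real" where
  "order_value c p G i = (INF x\<in>{0..p}. c * x + G (i + x))"

lemma order_value_attained:
  assumes G: "convex_on UNIV G" and p: "0 \<le> p"
  shows "\<exists>x\<in>{0..p}. order_value c p G i = c * x + G (i + x)"
    and "x \<in> {0..p} \<Longrightarrow> order_value c p G i \<le> c * x + G (i + x)"
proof -
  have "continuous_on {0..p} (\<lambda>x. c * x + G (x + i))"
    by (rule convex_on_UNIV_continuous[OF convex_on_affine_shift[OF G]])
  then have "continuous_on {0..p} (\<lambda>x. c * x + G (i + x))" by (simp add: add.commute)
  from continuous_attains_inf[OF compact_Icc _ this] p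
  obtain z where z: "z \<in> {0..p}" "\<And>x. x \<in> {0..p} \<Longrightarrow> c * z + G (i + z) \<le> c * x + G (i + x)"
    by auto
  have eq: "order_value c p G i = c * z + G (i + z)"
    unfolding order_value_def by (rule cInf_eq_minimum) (use z in auto)
  then show "\<exists>x\<in>{0..p}. order_value c p G i = c * x + G (i + x)" using z by blast
  show "x \<in> {0..p} \<Longrightarrow> order_value c p G i \<le> c * x + G (i + x)" using eq z by simp
qed

lemma convex_on_order_value:
  assumes G: "convex_on UNIV G" and p: "0 \<le> p"
  shows "convex_on UNIV (order_value c p G)"
proof (rule convex_onI)
  fix t i j :: real
  assume t: "0 < t" "t < 1"
  obtain x y where x: "x \<in> {0..p}" "order_value c p G i = c * x + G (i + x)"
    and y: "y \<in> {0..p}" "order_value c p G j = c * y + G (j + y)"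
    using order_value_attained(1)[OF G p] by metis
  let ?z = "(1 - t) * x + t * y"
  have "?z \<in> {0..p}" using convexD_alt[of "{0..p}" x y t] x y t by simp
  then have "order_value c p G ((1 - t) * i + t * j) \<le> c * ?z + G ((1 - t) * i + t * j + ?z)"
    by (rule order_value_attained(2)[OF G p])
  also have "(1 - t) * i + t * j + ?z = (1 - t) * (i + x) + t * (j + y)"
    by (simp add: algebra_simps)
  also have "G \<dots> \<le> (1 - t) * G (i + x) + t * G (j + y)"
    using convex_onD[OF G, of t "i + x" "j + y"] t by simp
  finally show "order_value c p G ((1 - t) *\<^sub>R i + t *\<^sub>R j)
      \<le> (1 - t) * order_value c p G i + t * order_value c p G j"
    by (simp add: x y algebra_simps)
qed simp

text \<open>
  A linear order cost \<open>c * x\<close> is \<open>c\<close> times the stock after ordering minus \<open>c\<close> times the stock before. Moving the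
  second part into the affine cost reduces the claim to \<open>order_step_free\<close> with \<open>H y = c * y + G y\<close>.
\<close>
lemma order_step:
  fixes a D :: "'a \<Rightarrow> real" and G :: "real \<Rightarrow> real"
  assumes fin: "finite A" and D: "\<And>s. s \<in> A \<Longrightarrow> 0 \<le> D s" and p: "0 \<le> p"
    and G: "convex_on UNIV G"
    and bound: "\<And>u. u \<in> unit_box \<Longrightarrow>
      \<alpha> + (\<Sum>s\<in>A. a s * u s) + order_value c p G (\<beta> - (\<Sum>s\<in>A. D s * u s)) \<le> V"
  obtains x0 x where "0 \<le> x0" "\<And>s. s \<in> A \<Longrightarrow> 0 \<le> x s \<and> x s \<le> D s" "x0 + (\<Sum>s\<in>A. x s) \<le> p"
    "\<And>u. u \<in> unit_box \<Longrightarrow> \<alpha> + c * x0 + (\<Sum>s\<in>A. (a s + c * x s) * u s)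
       + G (\<beta> + x0 - (\<Sum>s\<in>A. (D s - x s) * u s)) \<le> V"
proof -
  have H: "convex_on UNIV (\<lambda>y. c * y + G y)" using convex_on_affine_shift[OF G, of c 0] by simp
  have lin: "(\<Sum>s\<in>A. (a s + c * D s) * u s) = (\<Sum>s\<in>A. a s * u s) + c * (\<Sum>s\<in>A. D s * u s)" for u
    by (simp add: algebra_simps sum.distrib sum_distrib_left)
  obtain x0 x where x: "0 \<le> x0" "\<And>s. s \<in> A \<Longrightarrow> 0 \<le> x s \<and> x s \<le> D s" "x0 + (\<Sum>s\<in>A. x s) \<le> p"
    and xb: "\<And>u. u \<in> unit_box \<Longrightarrow> \<alpha> - c * \<beta> + (\<Sum>s\<in>A. (a s + c * D s) * u s)
       + (c * (\<beta> - (\<Sum>s\<in>A. D s * u s) + (x0 + (\<Sum>s\<in>A. x s * u s)))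
       + G (\<beta> - (\<Sum>s\<in>A. D s * u s) + (x0 + (\<Sum>s\<in>A. x s * u s)))) \<le> V"
  proof (rule order_step_free[of A D p "\<lambda>y. c * y + G y" "\<alpha> - c * \<beta>" "\<lambda>s. a s + c * D s" \<beta> V])
    fix u :: "'a \<Rightarrow> real" assume u: "u \<in> unit_box"
    obtain x where "x \<in> {0..p}"
      "order_value c p G (\<beta> - (\<Sum>s\<in>A. D s * u s)) = c * x + G (\<beta> - (\<Sum>s\<in>A. D s * u s) + x)"
      using order_value_attained(1)[OF G p] by blast
    then show "\<exists>x\<in>{0..p}. \<alpha> - c * \<beta> + (\<Sum>s\<in>A. (a s + c * D s) * u s)
       + (c * (\<beta> - (\<Sum>s\<in>A. D s * u s) + x) + G (\<beta> - (\<Sum>s\<in>A. D s * u s) + x)) \<le> V"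
      using bound[OF u] unfolding lin by (intro bexI[of _ x]) (auto simp: distrib_left right_diff_distrib)
  qed (use fin D p H in auto)
  show thesis
  proof (rule that[of x0 x])
    fix u :: "'a \<Rightarrow> real" assume u: "u \<in> unit_box"
    have eq: "\<beta> + x0 - (\<Sum>s\<in>A. (D s - x s) * u s) = \<beta> - (\<Sum>s\<in>A. D s * u s) + (x0 + (\<Sum>s\<in>A. x s * u s))"
      "(\<Sum>s\<in>A. (a s + c * x s) * u s) = (\<Sum>s\<in>A. a s * u s) + c * (\<Sum>s\<in>A. x s * u s)"
      by (simp_all add: algebra_simps sum.distrib sum_subtractf sum_distrib_left)
    show "\<alpha> + c * x0 + (\<Sum>s\<in>A. (a s + c * x s) * u s)
       + G (\<beta> + x0 - (\<Sum>s\<in>A. (D s - x s) * u s)) \<le> V"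
      using xb[OF u] unfolding eq lin by (simp add: distrib_left right_diff_distrib)
  qed (use x in auto)
qed

text \<open>
  The induction step of the forward construction: order, then let the demand with index \<open>k\<close> become known, then
  bound the stage cost. The invariant, affine cost plus cost-to-go at the affine stock is at most \<open>V\<close>, is
  passed on from the box over \<open>A\<close> to the box over \<open>insert k A\<close>.
\<close>
lemma period_step:
  fixes a D :: "'a \<Rightarrow> real" and J :: "real \<Rightarrow> real"
  assumes fin: "finite A" and new: "k \<notin> A" "a k = 0"
    and D: "\<And>s. s \<in> insert k A \<Longrightarrow> 0 \<le> D s" and p: "0 \<le> p" and h: "0 \<le> h" and b: "0 \<le> b"
    and J: "convex_on UNIV J"
    and bound: "\<And>u. u \<in> unit_box \<Longrightarrow> \<alpha> + (\<Sum>s\<in>A. a s * u s)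
      + order_value c p (worst_of_two (\<lambda>i. stage_cost h b i + J i) lo (lo + D k)) (\<beta> - (\<Sum>s\<in>A. D s * u s)) \<le> V"
  obtains x0 x z \<gamma> where "0 \<le> x0" "\<And>s. 0 \<le> x s" "\<And>s. s \<notin> A \<Longrightarrow> x s = 0"
    "\<And>s. s \<in> insert k A \<Longrightarrow> 0 \<le> D s - x s" "x0 + (\<Sum>s\<in>A. x s) \<le> p"
    "\<And>s. - b \<le> \<gamma> s \<and> \<gamma> s \<le> h" "\<And>s. s \<notin> insert k A \<Longrightarrow> \<gamma> s = 0"
    "h * (\<beta> + x0 - lo) \<le> z"
    "- b * (\<beta> + x0 - lo - (\<Sum>s\<in>insert k A. D s - x s)) \<le> z - (\<Sum>s\<in>insert k A. \<gamma> s * (D s - x s))"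
    "\<And>u. u \<in> unit_box \<Longrightarrow> \<alpha> + c * x0 + z + (\<Sum>s\<in>insert k A. (a s + c * x s - \<gamma> s * (D s - x s)) * u s)
      + J (\<beta> + x0 - lo - (\<Sum>s\<in>insert k A. (D s - x s) * u s)) \<le> V"
proof -
  let ?F = "\<lambda>i. stage_cost h b i + J i"
  have F: "convex_on UNIV ?F" by (intro convex_on_add convex_on_stage_cost J)
  obtain x0 y where x0: "0 \<le> x0" and y: "\<And>s. s \<in> A \<Longrightarrow> 0 \<le> y s \<and> y s \<le> D s"
    and cap: "x0 + (\<Sum>s\<in>A. y s) \<le> p"
    and yb: "\<And>u. u \<in> unit_box \<Longrightarrow> \<alpha> + c * x0 + (\<Sum>s\<in>A. (a s + c * y s) * u s)
       + worst_of_two ?F lo (lo + D k) (\<beta> + x0 - (\<Sum>s\<in>A. (D s - y s) * u s)) \<le> V"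
    by (rule order_step[where A = A and D = D and p = p and G = "worst_of_two ?F lo (lo + D k)"
          and \<alpha> = \<alpha> and a = a and c = c and \<beta> = \<beta> and V = V])
      (use fin D p convex_on_worst_of_two[OF F] bound in auto)
  define x where "x = (\<lambda>s. if s \<in> A then y s else 0)"
  have xA: "(\<Sum>s\<in>A. f s (x s)) = (\<Sum>s\<in>A. f s (y s))" for f :: "'a \<Rightarrow> real \<Rightarrow> real"
    by (rule sum.cong) (auto simp: x_def)
  have xk: "x k = 0" using new by (simp add: x_def)
  obtain z \<gamma> where g: "\<And>s. s \<in> insert k A \<Longrightarrow> - b \<le> \<gamma> s \<and> \<gamma> s \<le> h" and z: "h * (\<beta> + x0 - lo) \<le> z"
    "- b * (\<beta> + x0 - lo - (\<Sum>s\<in>insert k A. D s - x s)) \<le> z - (\<Sum>s\<in>insert k A. \<gamma> s * (D s - x s))"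
    and zb: "\<And>u. u \<in> unit_box \<Longrightarrow> \<alpha> + c * x0 + z
      + (\<Sum>s\<in>insert k A. (a s + c * x s - \<gamma> s * (D s - x s)) * u s)
      + J (\<beta> + x0 - lo - (\<Sum>s\<in>insert k A. (D s - x s) * u s)) \<le> V"
  proof (rule cost_step[of "insert k A" "\<lambda>s. D s - x s" h b J "\<alpha> + c * x0" "\<lambda>s. a s + c * x s"
        "\<beta> + x0 - lo" V])
    show "0 \<le> D s - x s" if "s \<in> insert k A" for s
      using that y[of s] D[of s] xk new by (auto simp: x_def)
    fix u :: "'a \<Rightarrow> real" assume u: "u \<in> unit_box"
    let ?i = "\<beta> + x0 - lo - (\<Sum>s\<in>insert k A. (D s - x s) * u s)"
    have eq1: "(\<Sum>s\<in>insert k A. (a s + c * x s) * u s) = (\<Sum>s\<in>A. (a s + c * y s) * u s)"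
      using fin new xk xA[of "\<lambda>s r. (a s + c * r) * u s"] by simp
    have eq2: "?i = \<beta> + x0 - (\<Sum>s\<in>A. (D s - y s) * u s) - lo - u k * D k"
      using fin new xk xA[of "\<lambda>s r. (D s - r) * u s"] by simp
    have "?F (\<beta> + x0 - (\<Sum>s\<in>A. (D s - y s) * u s) - lo - u k * D k)
        \<le> worst_of_two ?F lo (lo + D k) (\<beta> + x0 - (\<Sum>s\<in>A. (D s - y s) * u s))"
      using worst_of_two_interval[OF F] unit_boxD[OF u] by blast
    then show "\<alpha> + c * x0 + (\<Sum>s\<in>insert k A. (a s + c * x s) * u s)
       + max (h * ?i) (- b * ?i) + J ?i \<le> V"
      using yb[OF u] unfolding eq1 eq2 stage_cost_def by linarith
  qed (use fin h b J in auto)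
  define \<gamma>' where "\<gamma>' = (\<lambda>s. if s \<in> insert k A then \<gamma> s else 0)"
  have gA: "(\<Sum>s\<in>insert k A. f s (\<gamma>' s)) = (\<Sum>s\<in>insert k A. f s (\<gamma> s))" for f :: "'a \<Rightarrow> real \<Rightarrow> real"
    by (rule sum.cong) (auto simp: \<gamma>'_def)
  show thesis
  proof (rule that[of x0 x \<gamma>' z])
    show "0 \<le> x s" for s using y[of s] by (simp add: x_def)
    show "0 \<le> D s - x s" if "s \<in> insert k A" for s
      using that y[of s] D[of s] xk new by (auto simp: x_def)
    show "x0 + sum x A \<le> p" using cap xA[of "\<lambda>_ r. r"] by simp
    show "- b \<le> \<gamma>' s \<and> \<gamma>' s \<le> h" for s using g[of s] h b by (auto simp: \<gamma>'_def)
    show "- b * (\<beta> + x0 - lo - (\<Sum>s\<in>insert k A. D s - x s)) \<le> z - (\<Sum>s\<in>insert k A. \<gamma>' s * (D s - x s))"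
      using z(2) unfolding gA[of "\<lambda>s r. r * (D s - x s)"] .
    show "\<alpha> + c * x0 + z + (\<Sum>s\<in>insert k A. (a s + c * x s - \<gamma>' s * (D s - x s)) * u s)
      + J (\<beta> + x0 - lo - (\<Sum>s\<in>insert k A. (D s - x s) * u s)) \<le> V" if "u \<in> unit_box" for u
      using zb[OF that] unfolding gA[of "\<lambda>s r. (a s + c * x s - r * (D s - x s)) * u s"] .
  qed (use x0 z(1) in \<open>auto simp: x_def \<gamma>'_def\<close>)
qed

section \<open>Sparse nonnegative solutions of linear equations\<close>

definition linear_functional :: "(('a \<Rightarrow> real) \<Rightarrow> real) \<Rightarrow> bool" where
  "linear_functional f \<longleftrightarrow> (\<forall>x y r. f (\<lambda>j. x j + r * y j) = f x + r * f y)"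

lemma linear_functionalD: "linear_functional f \<Longrightarrow> f (\<lambda>j. x j + r * y j) = f x + r * f y"
  by (simp add: linear_functional_def)

text \<open>
  Elimination: two kernel vectors of \<open>K\<close>, the second of which vanishes at a coordinate where the first does not, can be
  combined into a nonzero vector on which one more functional vanishes.
\<close>
lemma common_kernel_vector:
  fixes f :: "'k \<Rightarrow> ('a \<Rightarrow> real) \<Rightarrow> real"
  assumes "finite K" "finite J" "card K < card J" "\<And>k. k \<in> K \<Longrightarrow> linear_functional (f k)"
  shows "\<exists>d. (\<forall>j. j \<notin> J \<longrightarrow> d j = 0) \<and> (\<exists>j. d j \<noteq> 0) \<and> (\<forall>k\<in>K. f k d = 0)"
  using assms
proof (induction K arbitrary: J rule: finite_induct)
  case empty
  then obtain i where "i \<in> J" by fastforce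
  then show ?case by (intro exI[of _ "\<lambda>j. if j = i then 1 else 0"]) auto
next
  case (insert k K)
  then have cJ: "card K < card J" by simp
  obtain d where d: "\<And>j. j \<notin> J \<Longrightarrow> d j = 0" "\<exists>j. d j \<noteq> 0" "\<And>l. l \<in> K \<Longrightarrow> f l d = 0"
    using insert.IH[OF insert.prems(1) cJ] insert.prems(3) by blast
  then obtain i where i: "i \<in> J" "d i \<noteq> 0" by blast
  have "card K < card (J - {i})" using insert i by simp
  then obtain e where e: "\<And>j. j \<notin> J - {i} \<Longrightarrow> e j = 0" "\<exists>j. e j \<noteq> 0" "\<And>l. l \<in> K \<Longrightarrow> f l e = 0"
    using insert.IH[of "J - {i}"] insert.prems by blast
  show ?case
  proof (cases "f k e = 0")
    case True
    then show ?thesis using e by (intro exI[of _ e]) auto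
  next
    case False
    define r where "r = - f k d / f k e"
    have "f l (\<lambda>j. d j + r * e j) = 0" if "l \<in> insert k K" for l
      using that d(3) e(3) False
      unfolding linear_functionalD[OF insert.prems(3)[OF that]] by (auto simp: r_def)
    moreover have "\<exists>j. d j + r * e j \<noteq> 0" using i e(1)[of i] by (intro exI[of _ i]) simp
    ultimately show ?thesis
      using d(1) e(1) by (intro exI[of _ "\<lambda>j. d j + r * e j"]) auto
  qed
qed

text \<open>
  The existence of basic feasible solutions. While the support is larger than the number of equations, some kernel
  vector is supported on it, and moving along that vector until the first coordinate vanishes shrinks the support.
\<close>
lemma sparse_nonneg_solution:
  fixes f :: "'k \<Rightarrow> ('a \<Rightarrow> real) \<Rightarrow> real"
  assumes K: "finite K" and f: "\<And>k. k \<in> K \<Longrightarrow> linear_functional (f k)"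
    and "finite {j. x j \<noteq> 0}" "\<And>j. 0 \<le> x j"
  shows "\<exists>y. (\<forall>j. 0 \<le> y j) \<and> (\<forall>j. x j = 0 \<longrightarrow> y j = 0) \<and> (\<forall>k\<in>K. f k y = f k x)
    \<and> card {j. y j \<noteq> 0} \<le> card K"
  using assms(3,4)
proof (induction "card {j. x j \<noteq> 0}" arbitrary: x rule: less_induct)
  case less
  show ?case
  proof (cases "card {j. x j \<noteq> 0} \<le> card K")
    case True
    then show ?thesis using less.prems by (intro exI[of _ x]) auto
  next
    case False
    obtain d where d: "\<And>j. x j = 0 \<Longrightarrow> d j = 0" "\<exists>j. d j \<noteq> 0" "\<And>k. k \<in> K \<Longrightarrow> f k d = 0"
      using common_kernel_vector[OF K less.prems(1), of f] False f by auto
    have "\<exists>e. (\<forall>j. x j = 0 \<longrightarrow> e j = 0) \<and> (\<exists>j. e j < 0) \<and> (\<forall>k\<in>K. f k e = 0)"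
    proof (cases "\<exists>j. d j < 0")
      case True then show ?thesis using d by blast
    next
      case nonneg: False
      have "f k (\<lambda>j. d j + (- 2) * d j) = 0" if "k \<in> K" for k
        using linear_functionalD[OF f[OF that], of d "- 2" d] d(3)[OF that] by simp
      moreover have "\<exists>j. d j + (- 2) * d j < 0"
      proof -
        obtain j where "d j > 0" using d(2) nonneg by (metis linorder_neqE_linordered_idom)
        then show ?thesis by (intro exI[of _ j]) simp
      qed
      ultimately show ?thesis using d(1) by (intro exI[of _ "\<lambda>j. d j + (- 2) * d j"]) auto
    qed
    then obtain e where e: "\<And>j. x j = 0 \<Longrightarrow> e j = 0" "\<exists>j. e j < 0" "\<And>k. k \<in> K \<Longrightarrow> f k e = 0"
      by blast
    let ?N = "{j. e j < 0}"
    have finN: "finite ?N" by (rule finite_subset[OF _ less.prems(1)]) (use e(1) in force)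
    define r where "r = Min ((\<lambda>j. x j / - e j) ` ?N)"
    have "r \<in> (\<lambda>j. x j / - e j) ` ?N" unfolding r_def
      by (rule Min_in) (use finN e(2) in auto)
    then obtain i where i: "e i < 0" "r = x i / - e i" by blast
    have r_le: "r \<le> x j / - e j" if "e j < 0" for j
      unfolding r_def by (rule Min_le) (use finN that in auto)
    have r0: "0 \<le> r" using i less.prems(2)[of i] by (simp add: divide_nonneg_neg)
    define w where "w = (\<lambda>j. x j + r * e j)"
    have w0: "0 \<le> w j" for j
    proof (cases "e j < 0")
      case True
      then show ?thesis using r_le[OF True] by (simp add: w_def field_simps)
    next
      case False
      then show ?thesis using r0 less.prems(2)[of j] by (simp add: w_def)
    qed
    have wx: "w j = 0" if "x j = 0" for j using that e(1) by (simp add: w_def)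
    have "x i \<noteq> 0" using e(1)[of i] i by auto
    moreover have "w i = 0" using i by (simp add: w_def)
    ultimately have "{j. w j \<noteq> 0} \<subset> {j. x j \<noteq> 0}" using wx by auto
    then have "card {j. w j \<noteq> 0} < card {j. x j \<noteq> 0}" "finite {j. w j \<noteq> 0}"
      using less.prems(1) by (auto intro: psubset_card_mono finite_subset)
    from less.hyps[OF this w0] obtain y where y: "\<And>j. 0 \<le> y j" "\<And>j. w j = 0 \<Longrightarrow> y j = 0"
      "\<And>k. k \<in> K \<Longrightarrow> f k y = f k w" "card {j. y j \<noteq> 0} \<le> card K" by blast
    have "f k w = f k x" if "k \<in> K" for k
      using linear_functionalD[OF f[OF that], of x r e] e(3)[OF that] by (simp add: w_def)
    with y wx show ?thesis by (intro exI[of _ y]) auto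
  qed
qed

section \<open>The robust cost-to-go as a lower bound\<close>

locale newsvendor =
  fixes T :: nat and v1 :: real and c p h b Dlo Dhi :: "nat \<Rightarrow> real"
  assumes hb: "t \<in> {1..T} \<Longrightarrow> 0 \<le> h t \<and> 0 \<le> b t"
    and capacity: "t \<in> {1..T} \<Longrightarrow> 0 \<le> p t"
    and first_demand: "Dlo 1 = 1" "Dhi 1 = 1"
    and demand_interval: "t \<in> {2..T+1} \<Longrightarrow> Dlo t < Dhi t"
begin

abbreviation "uncertainty \<equiv> uncertainty_set T Dlo Dhi"

text \<open>
  The value of the problem in which orders may depend arbitrarily on past demands, by backward recursion. The
  argument counts the periods that are left, so the next order is the one of period \<open>T - r\<close>.
\<close>
primrec cost_to_go_rem :: "nat \<Rightarrow> real \<Rightarrow> real" where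
  "cost_to_go_rem 0 = (\<lambda>i. 0)"
| "cost_to_go_rem (Suc r) = (let t = T - r in
     order_value (c t) (p t)
       (worst_of_two (\<lambda>i. stage_cost (h t) (b t) i + cost_to_go_rem r i) (Dlo (t + 1)) (Dhi (t + 1))))"

definition cost_to_go :: "nat \<Rightarrow> real \<Rightarrow> real" where
  "cost_to_go t = cost_to_go_rem (T + 1 - t)"

definition cost_after_order :: "nat \<Rightarrow> real \<Rightarrow> real" where
  "cost_after_order t = worst_of_two (\<lambda>i. stage_cost (h t) (b t) i + cost_to_go (t + 1) i)
     (Dlo (t + 1)) (Dhi (t + 1))"

lemma cost_to_go_end: "cost_to_go (Suc T) = (\<lambda>i. 0)"
  by (simp add: cost_to_go_def)

lemma cost_to_go_rec:
  assumes "t \<in> {1..T}"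
  shows "cost_to_go t = order_value (c t) (p t) (cost_after_order t)"
proof -
  have "T + 1 - t = Suc (T - t)" "T - (T - t) = t" using assms by auto
  then show ?thesis by (simp add: cost_to_go_def cost_after_order_def)
qed

lemma convex_cost_to_go: "convex_on UNIV (cost_to_go t)" if "1 \<le> t"
proof (cases "t \<le> T")
  case False
  then have "cost_to_go t = (\<lambda>i. 0)" by (simp add: cost_to_go_def)
  then show ?thesis by (simp add: convex_on_const)
next
  case True
  from True that show ?thesis
  proof (induction rule: inc_induct)
    case base
    then have "convex_on UNIV (cost_to_go (T + 1))"
      by (simp add: cost_to_go_end convex_on_const)
    then show ?case using base
      by (subst cost_to_go_rec)
        (auto simp: cost_after_order_def capacity
          intro!: convex_on_order_value convex_on_worst_of_two convex_on_add convex_on_stage_cost)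
  next
    case (step n)
    then show ?case
      by (subst cost_to_go_rec)
        (auto simp: cost_after_order_def capacity
          intro!: convex_on_order_value convex_on_worst_of_two convex_on_add convex_on_stage_cost)
  qed
qed

lemma convex_cost_after_order: "convex_on UNIV (cost_after_order t)"
  unfolding cost_after_order_def
  by (intro convex_on_worst_of_two convex_on_add convex_on_stage_cost convex_cost_to_go) simp

text \<open>
  The order of period \<open>t\<close> is followed by the demand with index \<open>t + 1\<close>, so this is the stock to which the stage
  cost of period \<open>t\<close> applies.
\<close>
definition inventory :: "(nat \<Rightarrow> real) \<Rightarrow> (nat \<Rightarrow> real) \<Rightarrow> nat \<Rightarrow> real" where
  "inventory x \<zeta> t = v1 + (\<Sum>s=1..t. x s) - (\<Sum>s=2..t+1. \<zeta> s)"

lemma newsvendor_cost_stage: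
  "newsvendor_cost T v1 c h b x \<zeta> = (\<Sum>t=1..T. c t * x t + stage_cost (h t) (b t) (inventory x \<zeta> t))"
  unfolding newsvendor_cost_def
proof (rule sum.cong[OF refl])
  fix t assume "t \<in> {1..T}"
  then have nonneg: "0 \<le> h t" "0 \<le> b t" using hb by auto
  have split: "h t * max i 0 + b t * max (- i) 0 = stage_cost (h t) (b t) i" for i
  proof (cases "0 \<le> i")
    case True
    then have "- b t * i \<le> 0" "0 \<le> h t * i" using nonneg by auto
    then show ?thesis using True by (simp add: stage_cost_def)
  next
    case False
    then have "0 \<le> - b t * i" "h t * i \<le> 0"
      using nonneg by (auto simp: mult_nonneg_nonpos)
    then show ?thesis using False by (simp add: stage_cost_def)
  qed
  have "v1 + sum x {1..t} - sum \<zeta> {2..t + 1} = inventory x \<zeta> t"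
    "- v1 - sum x {1..t} + sum \<zeta> {2..t + 1} = - inventory x \<zeta> t" by (simp_all add: inventory_def)
  then show "c t * x t + h t * max (v1 + sum x {1..t} - sum \<zeta> {2..t + 1}) 0 +
      b t * max (- v1 - sum x {1..t} + sum \<zeta> {2..t + 1}) 0
      = c t * x t + stage_cost (h t) (b t) (inventory x \<zeta> t)"
    using split[of "inventory x \<zeta> t"] by (simp only:)
qed

lemma demand_le: "t \<in> {1..T+1} \<Longrightarrow> Dlo t \<le> Dhi t"
  using first_demand demand_interval[of t] by (cases "t = 1") auto

lemma ldr_order_cong:
  "(\<And>s. s \<in> {1..t} \<Longrightarrow> \<zeta> s = \<zeta>' s) \<Longrightarrow> ldr_order y \<zeta> t = ldr_order y \<zeta>' t"
  unfolding ldr_order_def by (rule sum.cong) auto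

text \<open>
  The order of period \<open>t\<close> is fixed by the demands up to \<open>t\<close>. Answering it with the worse endpoint of the next
  demand interval costs at least the cost-to-go, and the same strategy continues from the following period.
\<close>
lemma adversary:
  assumes y: "y \<in> ldr_feasible T p Dlo Dhi" and t: "t \<in> {1..T+1}" and "\<zeta> \<in> uncertainty"
  shows "\<exists>\<xi>\<in>uncertainty. (\<forall>s\<in>{1..t}. \<xi> s = \<zeta> s) \<and>
    cost_to_go t (inventory (ldr_order y \<zeta>) \<zeta> (t - 1))
      \<le> (\<Sum>\<tau>=t..T. c \<tau> * ldr_order y \<xi> \<tau> + stage_cost (h \<tau>) (b \<tau>) (inventory (ldr_order y \<xi>) \<xi> \<tau>))"
proof -
  have "t \<le> T + 1" "1 \<le> t" using t by auto
  from this assms(3) show ?thesis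
  proof (induction arbitrary: \<zeta> rule: inc_induct)
    case base
    then show ?case by (intro bexI[of _ \<zeta>]) (auto simp: cost_to_go_end)
  next
    case (step t)
    then have tT: "t \<in> {1..T}" by auto
    let ?x = "ldr_order y \<zeta> t" and ?i = "inventory (ldr_order y \<zeta>) \<zeta> (t - 1)"
    let ?F = "\<lambda>i. stage_cost (h t) (b t) i + cost_to_go (t + 1) i"
    have "?x \<in> {0..p t}" using y step.prems tT by (auto simp: ldr_feasible_def)
    then have le: "cost_to_go t ?i \<le> c t * ?x + cost_after_order t (?i + ?x)"
      unfolding cost_to_go_rec[OF tT]
      by (rule order_value_attained(2)[OF convex_cost_after_order capacity[OF tT]])
    obtain d where d: "d \<in> {Dlo (t + 1)..Dhi (t + 1)}" and dF: "cost_after_order t (?i + ?x) = ?F (?i + ?x - d)"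
    proof (cases "?F (?i + ?x - Dhi (t + 1)) \<le> ?F (?i + ?x - Dlo (t + 1))")
      case True
      then show ?thesis using demand_le[of "t + 1"] tT
        by (intro that[of "Dlo (t + 1)"]) (auto simp: cost_after_order_def worst_of_two_def)
    next
      case False
      then show ?thesis using demand_le[of "t + 1"] tT
        by (intro that[of "Dhi (t + 1)"]) (auto simp: cost_after_order_def worst_of_two_def)
    qed
    define \<zeta>' where "\<zeta>' = \<zeta>(t + 1 := d)"
    have \<zeta>': "\<zeta>' \<in> uncertainty"
      using step.prems d tT by (auto simp: \<zeta>'_def uncertainty_set_def PiE_iff extensional_def)
    have upto: "ldr_order y \<zeta>' s = ldr_order y \<zeta> s" if "s \<le> t" for s
      by (rule ldr_order_cong) (use that in \<open>auto simp: \<zeta>'_def\<close>)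
    have inv: "inventory (ldr_order y \<zeta>') \<zeta>' t = ?i + ?x - d"
    proof -
      have "(\<Sum>s=1..t. ldr_order y \<zeta>' s) = (\<Sum>s=1..t. ldr_order y \<zeta> s)"
        by (rule sum.cong) (auto simp: upto)
      also have "\<dots> = (\<Sum>s=1..t-1. ldr_order y \<zeta> s) + ?x"
        using tT by (cases t) auto
      moreover have "(\<Sum>s=2..t+1. \<zeta>' s) = (\<Sum>s=2..t. \<zeta>' s) + d"
        using tT by (simp add: \<zeta>'_def)
      moreover have "(\<Sum>s=2..t. \<zeta>' s) = (\<Sum>s=2..t-1+1. \<zeta> s)"
        using tT by (intro sum.cong) (auto simp: \<zeta>'_def)
      ultimately show ?thesis by (simp add: inventory_def)
    qed
    obtain \<xi> where \<xi>: "\<xi> \<in> uncertainty" "\<forall>s\<in>{1..Suc t}. \<xi> s = \<zeta>' s"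
      and IH: "cost_to_go (Suc t) (inventory (ldr_order y \<zeta>') \<zeta>' t)
        \<le> (\<Sum>\<tau>=Suc t..T. c \<tau> * ldr_order y \<xi> \<tau> + stage_cost (h \<tau>) (b \<tau>) (inventory (ldr_order y \<xi>) \<xi> \<tau>))"
      using step.IH[of \<zeta>'] \<zeta>' by auto
    have \<xi>x: "ldr_order y \<xi> s = ldr_order y \<zeta>' s" if "s \<le> t" for s
      by (rule ldr_order_cong) (use that \<xi>(2) in auto)
    have \<xi>i: "inventory (ldr_order y \<xi>) \<xi> t = ?i + ?x - d"
    proof -
      have "(\<Sum>s=1..t. ldr_order y \<xi> s) = (\<Sum>s=1..t. ldr_order y \<zeta>' s)"
        by (rule sum.cong) (auto simp: \<xi>x)
      moreover have "(\<Sum>s=2..t+1. \<xi> s) = (\<Sum>s=2..t+1. \<zeta>' s)"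
        by (rule sum.cong) (use \<xi>(2) in auto)
      ultimately show ?thesis using inv by (simp add: inventory_def)
    qed
    have "cost_to_go t ?i \<le> c t * ?x + ?F (?i + ?x - d)" using le dF by simp
    also have "\<dots> \<le> (\<Sum>\<tau>=t..T. c \<tau> * ldr_order y \<xi> \<tau> + stage_cost (h \<tau>) (b \<tau>) (inventory (ldr_order y \<xi>) \<xi> \<tau>))"
      using IH tT \<xi>x[of t] upto[of t] \<xi>i inv by (subst sum.atLeast_Suc_atMost) auto
    finally have "cost_to_go t ?i \<le> \<dots>" .
    moreover have "\<forall>s\<in>{1..t}. \<xi> s = \<zeta> s" using \<xi>(2) by (auto simp: \<zeta>'_def)
    ultimately show ?case using \<xi>(1) by blast
  qed
qed

lemma cost_to_go_lower_bound:
  assumes y: "y \<in> ldr_feasible T p Dlo Dhi"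
  shows "cost_to_go 1 v1 \<le> worst_case_cost T v1 c h b Dlo Dhi y"
proof -
  obtain \<zeta> where \<zeta>: "\<zeta> \<in> uncertainty"
    and wc: "worst_case_cost T v1 c h b Dlo Dhi y = newsvendor_cost T v1 c h b (ldr_order y \<zeta>) \<zeta>"
    and max: "\<And>\<xi>. \<xi> \<in> uncertainty \<Longrightarrow>
      newsvendor_cost T v1 c h b (ldr_order y \<xi>) \<xi> \<le> newsvendor_cost T v1 c h b (ldr_order y \<zeta>) \<zeta>"
    by (rule worst_case_cost_attained[of T Dlo Dhi v1 c h b y], erule demand_le, (rule that; blast))
  obtain \<xi> where "\<xi> \<in> uncertainty"
    "cost_to_go 1 (inventory (ldr_order y \<zeta>) \<zeta> 0) \<le> newsvendor_cost T v1 c h b (ldr_order y \<xi>) \<xi>"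
    using adversary[OF y _ \<zeta>, of 1] unfolding newsvendor_cost_stage by auto
  with max[of \<xi>] wc show ?thesis by (simp add: inventory_def)
qed

section \<open>Certificates for linear decision rules\<close>

text \<open>
  Demands are parametrised as \<open>\<zeta> s = Dlo s + gap s * u s\<close> with \<open>u\<close> in the unit box.
\<close>
definition gap :: "nat \<Rightarrow> real" where
  "gap s = Dhi s - Dlo s"

text \<open>
  The order of period \<open>t\<close> has the form \<open>x0 t + (\<Sum>s. x (t, s) * u s)\<close>. After period \<open>t\<close> the inventory is
  \<open>base_inventory x0 t - (\<Sum>s=2..t+1. unserved x t s * u s)\<close>: the coefficient is the part of the uncertain demand \<open>s\<close> that
  the orders have not yet made up for.
\<close>
definition unserved :: "(nat \<times> nat \<Rightarrow> real) \<Rightarrow> nat \<Rightarrow> nat \<Rightarrow> real" where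
  "unserved x t s = gap s - (\<Sum>\<tau>=1..t. x (\<tau>, s))"

definition base_inventory :: "(nat \<Rightarrow> real) \<Rightarrow> nat \<Rightarrow> real" where
  "base_inventory x0 t = v1 + (\<Sum>\<tau>=1..t. x0 \<tau>) - (\<Sum>s=2..t+1. Dlo s)"

text \<open>
  The slope in \<open>u s\<close> of the total cost bound, when the stage cost of period \<open>t\<close> is replaced by
  \<open>z t - (\<Sum>s. \<gamma> t s * unserved x t s * u s)\<close>.
\<close>
definition cost_slope :: "(nat \<times> nat \<Rightarrow> real) \<Rightarrow> (nat \<Rightarrow> nat \<Rightarrow> real) \<Rightarrow> nat \<Rightarrow> nat \<Rightarrow> real" where
  "cost_slope x \<gamma> n s = (\<Sum>t=1..n. c t * x (t, s) - \<gamma> t s * unserved x t s)"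

text \<open>
  The data of a rule for the first \<open>n\<close> periods together with affine bounds on their stage costs, witnessing that the
  rule is feasible and that cost so far plus cost-to-go does not exceed the value of the adaptive problem. The
  conditions on \<open>\<gamma>\<close> and \<open>z\<close> are those of \<open>cost_step\<close>; only the values at the two extreme corners of the box
  enter. For \<open>n = T\<close> the cost-to-go vanishes, and for fixed \<open>x0\<close>, \<open>z\<close> and \<open>\<gamma>\<close> every condition is then linear in
  the coefficients \<open>x\<close>, which is what \<open>certificate_sparse\<close> exploits.
\<close>
definition certificate :: "nat \<Rightarrow> (nat \<Rightarrow> real) \<Rightarrow> (nat \<times> nat \<Rightarrow> real) \<Rightarrow> (nat \<Rightarrow> real) \<Rightarrow>
    (nat \<Rightarrow> nat \<Rightarrow> real) \<Rightarrow> bool" where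
  "certificate n x0 x z \<gamma> \<longleftrightarrow>
    (\<forall>j. 0 \<le> x j) \<and> (\<forall>t s. x (t, s) \<noteq> 0 \<longrightarrow> 2 \<le> s \<and> s \<le> t \<and> t \<le> n) \<and>
    (\<forall>s\<in>{2..T+1}. 0 \<le> unserved x n s) \<and>
    (\<forall>t\<in>{1..n}. 0 \<le> x0 t \<and> x0 t + (\<Sum>s=2..T+1. x (t, s)) \<le> p t \<and>
      (\<forall>s. - b t \<le> \<gamma> t s \<and> \<gamma> t s \<le> h t) \<and> (\<forall>s. s \<notin> {2..t+1} \<longrightarrow> \<gamma> t s = 0) \<and>
      h t * base_inventory x0 t \<le> z t \<and>
      - b t * (base_inventory x0 t - (\<Sum>s=2..t+1. unserved x t s))
        \<le> z t - (\<Sum>s=2..T+1. \<gamma> t s * unserved x t s)) \<and>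
    (\<forall>u\<in>unit_box. (\<Sum>t=1..n. c t * x0 t + z t) + (\<Sum>s=2..n+1. cost_slope x \<gamma> n s * u s)
      + cost_to_go (n + 1) (base_inventory x0 n - (\<Sum>s=2..n+1. unserved x n s * u s)) \<le> cost_to_go 1 v1)"

lemma certificate_0: "certificate 0 x0 (\<lambda>_. 0) z \<gamma>"
  unfolding certificate_def
  using demand_interval by (auto simp: unserved_def gap_def base_inventory_def less_imp_le)

lemma certificate_Suc:
  assumes cert: "certificate n x0 x z \<gamma>" and n: "n < T"
  shows "\<exists>x0 x z \<gamma>. certificate (Suc n) x0 x z \<gamma>"
proof -
  have x: "\<And>j. 0 \<le> x j" and supp: "\<And>t s. x (t, s) \<noteq> 0 \<Longrightarrow> 2 \<le> s \<and> s \<le> t \<and> t \<le> n"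
    and uns: "\<And>s. s \<in> {2..T+1} \<Longrightarrow> 0 \<le> unserved x n s"
    and per: "\<And>t. t \<in> {1..n} \<Longrightarrow> 0 \<le> x0 t \<and> x0 t + (\<Sum>s=2..T+1. x (t, s)) \<le> p t \<and>
      (\<forall>s. - b t \<le> \<gamma> t s \<and> \<gamma> t s \<le> h t) \<and> (\<forall>s. s \<notin> {2..t+1} \<longrightarrow> \<gamma> t s = 0) \<and>
      h t * base_inventory x0 t \<le> z t \<and>
      - b t * (base_inventory x0 t - (\<Sum>s=2..t+1. unserved x t s))
        \<le> z t - (\<Sum>s=2..T+1. \<gamma> t s * unserved x t s)"
    and bnd: "\<And>u. u \<in> unit_box \<Longrightarrow> (\<Sum>t=1..n. c t * x0 t + z t) + (\<Sum>s=2..n+1. cost_slope x \<gamma> n s * u s)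
      + cost_to_go (n + 1) (base_inventory x0 n - (\<Sum>s=2..n+1. unserved x n s * u s)) \<le> cost_to_go 1 v1"
    using cert unfolding certificate_def by blast+
  \<comment> \<open>The demand that becomes known after the order of period \<open>?t\<close> has index \<open>?k\<close>.\<close>
  let ?k = "n + 2" and ?t = "Suc n"
  have t: "?t \<in> {1..T}" using n by auto
  have ins: "insert ?k {2..n+1} = {2..n+2}" by auto
  have xk: "x (t, ?k) = 0" for t using supp[of t ?k] by (cases "x (t, ?k) = 0") auto
  have gk: "\<gamma> t ?k = 0" if "t \<in> {1..n}" for t using per[OF that] that by auto
  have slope_k: "cost_slope x \<gamma> n ?k = 0" unfolding cost_slope_def
    by (rule sum.neutral) (use xk gk in auto)
  have unk: "Dlo ?k + unserved x n ?k = Dhi ?k" unfolding unserved_def gap_def xk by simp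
  obtain y0 y w g where y0: "0 \<le> y0" and y: "\<And>s. 0 \<le> y s" "\<And>s. s \<notin> {2..n+1} \<Longrightarrow> y s = 0"
    and yD: "\<And>s. s \<in> {2..n+2} \<Longrightarrow> 0 \<le> unserved x n s - y s"
    and cap: "y0 + (\<Sum>s=2..n+1. y s) \<le> p ?t"
    and g: "\<And>s. - b ?t \<le> g s \<and> g s \<le> h ?t" "\<And>s. s \<notin> {2..n+2} \<Longrightarrow> g s = 0"
    and w: "h ?t * (base_inventory x0 n + y0 - Dlo ?k) \<le> w"
      "- b ?t * (base_inventory x0 n + y0 - Dlo ?k - (\<Sum>s\<in>{2..n+2}. unserved x n s - y s))
        \<le> w - (\<Sum>s\<in>{2..n+2}. g s * (unserved x n s - y s))"
    and yb: "\<And>u. u \<in> unit_box \<Longrightarrow> (\<Sum>t=1..n. c t * x0 t + z t) + c ?t * y0 + w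
      + (\<Sum>s\<in>{2..n+2}. (cost_slope x \<gamma> n s + c ?t * y s - g s * (unserved x n s - y s)) * u s)
      + cost_to_go (n + 2) (base_inventory x0 n + y0 - Dlo ?k - (\<Sum>s\<in>{2..n+2}. (unserved x n s - y s) * u s))
      \<le> cost_to_go 1 v1"
  proof -
    have D: "0 \<le> unserved x n s" if "s \<in> insert ?k {2..n+1}" for s
      using that n by (intro uns) auto
    have J: "convex_on UNIV (cost_to_go (n + 2))" by (rule convex_cost_to_go) simp
    have bound: "(\<Sum>t=1..n. c t * x0 t + z t) + (\<Sum>s=2..n+1. cost_slope x \<gamma> n s * u s)
      + order_value (c ?t) (p ?t) (worst_of_two (\<lambda>i. stage_cost (h ?t) (b ?t) i + cost_to_go (n + 2) i)
          (Dlo ?k) (Dlo ?k + unserved x n ?k))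
        (base_inventory x0 n - (\<Sum>s=2..n+1. unserved x n s * u s)) \<le> cost_to_go 1 v1"
      if "u \<in> unit_box" for u
      using bnd[OF that] cost_to_go_rec[OF t] unfolding unk by (simp add: cost_after_order_def)
    have fin: "finite {2..n+1}" "?k \<notin> {2..n+1}" by auto
    show thesis
      by (rule period_step[OF fin slope_k D capacity[OF t] conjunct1[OF hb[OF t]] conjunct2[OF hb[OF t]] J bound,
            unfolded ins])
        (assumption | rule that)+
  qed
  define x' where "x' = (\<lambda>(t, s). if t = ?t then y s else x (t, s))"
  define x0' where "x0' = x0(?t := y0)"
  define z' where "z' = z(?t := w)"
  define \<gamma>' where "\<gamma>' = \<gamma>(?t := g)"
  have old: "unserved x' t s = unserved x t s" "base_inventory x0' t = base_inventory x0 t" if "t \<le> n" for t s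
    using that by (auto simp: unserved_def base_inventory_def x'_def x0'_def intro!: sum.cong)
  have old_row: "x' (t, s) = x (t, s)" "\<gamma>' t s = \<gamma> t s" if "t \<le> n" for t s
    using that by (auto simp: x'_def \<gamma>'_def)
  have new_row: "x' (?t, s) = y s" "\<gamma>' ?t s = g s" for s
    by (auto simp: x'_def \<gamma>'_def)
  have newu: "unserved x' ?t s = unserved x n s - y s" for s
    using old(1)[of n s] by (simp add: unserved_def x'_def)
  have newb: "base_inventory x0' ?t = base_inventory x0 n + y0 - Dlo ?k"
    using old(2)[of n] by (simp add: base_inventory_def x0'_def)
  have news: "cost_slope x' \<gamma>' ?t s = cost_slope x \<gamma> n s + c ?t * y s - g s * (unserved x n s - y s)" for s
  proof -
    have "cost_slope x' \<gamma>' n s = cost_slope x \<gamma> n s" unfolding cost_slope_def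
      by (rule sum.cong) (simp_all add: old old_row)
    then show ?thesis by (simp add: cost_slope_def newu new_row)
  qed
  have tot: "(\<Sum>t=1..n. c t * x0' t + z' t) = (\<Sum>t=1..n. c t * x0 t + z t)"
    by (rule sum.cong) (auto simp: x0'_def z'_def)
  have "certificate ?t x0' x' z' \<gamma>'"
    unfolding certificate_def
  proof (intro conjI allI ballI impI)
    show "0 \<le> x' j" for j using x y by (auto simp: x'_def split: prod.splits)
    fix t s assume "x' (t, s) \<noteq> 0"
    then show "2 \<le> s" "s \<le> t" "t \<le> ?t"
      using supp[of t s] y(2)[of s] by (auto simp: x'_def split: if_splits)
  next
    fix s assume "s \<in> {2..T+1}"
    then show "0 \<le> unserved x' ?t s"
      unfolding newu using yD[of s] uns[of s] y(2)[of s] by (cases "s \<le> n + 2") auto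
  next
    fix t s assume t': "t \<in> {1..?t}"
    show "- b t \<le> \<gamma>' t s" "\<gamma>' t s \<le> h t"
      using per[of t] g(1)[of s] t' by (auto simp: \<gamma>'_def)
    show "s \<notin> {2..t+1} \<Longrightarrow> \<gamma>' t s = 0"
      using per[of t] g(2)[of s] t' by (auto simp: \<gamma>'_def)
  next
    fix t assume t': "t \<in> {1..?t}"
    have sy: "(\<Sum>s=2..T+1. y s) = (\<Sum>s=2..n+1. y s)"
      by (rule sum.mono_neutral_right) (use n y(2) in auto)
    have sg: "(\<Sum>s=2..T+1. g s * (unserved x n s - y s)) = (\<Sum>s\<in>{2..n+2}. g s * (unserved x n s - y s))"
      by (rule sum.mono_neutral_right) (use n g(2) in auto)
    show "0 \<le> x0' t" using per[of t] y0 t' by (auto simp: x0'_def)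
    show "x0' t + (\<Sum>s=2..T+1. x' (t, s)) \<le> p t"
    proof (cases "t = ?t")
      case True then show ?thesis using cap sy by (simp add: x0'_def new_row)
    next
      case False then show ?thesis using per[of t] t' by (simp add: x0'_def old_row)
    qed
    show "h t * base_inventory x0' t \<le> z' t"
    proof (cases "t = ?t")
      case True then show ?thesis using w(1) newb by (simp add: z'_def)
    next
      case False then show ?thesis using per[of t] t' old by (simp add: z'_def)
    qed
    show "- b t * (base_inventory x0' t - (\<Sum>s=2..t+1. unserved x' t s))
        \<le> z' t - (\<Sum>s=2..T+1. \<gamma>' t s * unserved x' t s)"
    proof (cases "t = ?t")
      case True
      have "{2..?t+1} = {2..n+2}" by auto
      with w(2) sg show ?thesis unfolding True newb newu new_row z'_def by simp
    next
      case False then show ?thesis using per[of t] t' old by (simp add: z'_def old_row)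
    qed
  next
    fix u :: "nat \<Rightarrow> real" assume u: "u \<in> unit_box"
    have "{2..?t+1} = {2..n+2}" "?t + 1 = n + 2" by auto
    moreover have "(\<Sum>t=1..?t. c t * x0' t + z' t) = (\<Sum>t=1..n. c t * x0 t + z t) + c ?t * y0 + w"
      using tot by (simp add: x0'_def z'_def)
    ultimately show "(\<Sum>t=1..?t. c t * x0' t + z' t) + (\<Sum>s=2..?t+1. cost_slope x' \<gamma>' ?t s * u s)
      + cost_to_go (?t + 1) (base_inventory x0' ?t - (\<Sum>s=2..?t+1. unserved x' ?t s * u s)) \<le> cost_to_go 1 v1"
      using yb[OF u] unfolding news newb newu by simp
  qed
  then show ?thesis by blast
qed

lemma certificate_exists: "\<exists>x0 x z \<gamma>. certificate T x0 x z \<gamma>"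
proof -
  have "n \<le> T \<Longrightarrow> \<exists>x0 x z \<gamma>. certificate n x0 x z \<gamma>" for n
  proof (induction n)
    case 0 show ?case using certificate_0 by blast
  next
    case (Suc n) then show ?case using certificate_Suc by (metis Suc_le_lessD Suc_leD)
  qed
  then show ?thesis by simp
qed

text \<open>
  With \<open>x0\<close>, \<open>z\<close> and \<open>\<gamma>\<close> fixed, the coefficients \<open>x\<close> enter a certificate only through their signs, their support
  and four families of \<open>T\<close> linear functionals each: the row sums (capacity, and the inventory at \<open>u = 1\<close>), the
  column sums (final values of \<open>unserved\<close>), the \<open>\<gamma>\<close>-weighted sums (stage cost bound at \<open>u = 1\<close>) and the slopes of the total
  cost. Any nonnegative vector whose support lies in that of \<open>x\<close> and on which they take the same values again gives a
  certificate.
\<close>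
lemma certificate_sparse:
  assumes cert: "certificate T x0 x z \<gamma>"
  shows "\<exists>y. certificate T x0 y z \<gamma> \<and> card {j. y j \<noteq> 0} \<le> 4 * T"
proof -
  have x: "\<And>j. 0 \<le> x j" and supp: "\<And>t s. x (t, s) \<noteq> 0 \<Longrightarrow> 2 \<le> s \<and> s \<le> t \<and> t \<le> T"
    using cert unfolding certificate_def by blast+
  have "{j. x j \<noteq> 0} \<subseteq> {..T} \<times> {..T}" using supp by fastforce
  then have fin: "finite {j. x j \<noteq> 0}" by (rule finite_subset) simp
  \<comment> \<open>Columns have indices \<open>2..T+1\<close>, whence the shift \<open>t + 1\<close>; in the last two families the constant terms that stem from
    \<open>gap\<close> are dropped.\<close>
  define f where "f = (\<lambda>(e :: nat, t) (x :: nat \<times> nat \<Rightarrow> real).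
     if e = 0 then \<Sum>s=2..T+1. x (t, s)
     else if e = 1 then \<Sum>\<tau>=1..T. x (\<tau>, t + 1)
     else if e = 2 then \<Sum>s=2..T+1. \<gamma> t s * (\<Sum>\<tau>=1..t. x (\<tau>, s))
     else \<Sum>\<tau>=1..T. c \<tau> * x (\<tau>, t + 1) + \<gamma> \<tau> (t + 1) * (\<Sum>\<sigma>=1..\<tau>. x (\<sigma>, t + 1)))"
  have lin: "linear_functional (f k)" for k
    unfolding linear_functional_def f_def
    by (auto simp: split_beta sum.distrib sum_distrib_left algebra_simps)
  obtain y where y: "\<And>j. 0 \<le> y j" "\<And>j. x j = 0 \<Longrightarrow> y j = 0"
    and eq: "\<And>k. k \<in> {0..<4} \<times> {1..T} \<Longrightarrow> f k y = f k x"
    and card: "card {j. y j \<noteq> 0} \<le> card ({0..<4::nat} \<times> {1..T})"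
    using sparse_nonneg_solution[of "{0..<4} \<times> {1..T}" f x, OF _ lin fin x] by blast
  have ysupp: "2 \<le> s \<and> s \<le> t \<and> t \<le> T" if "y (t, s) \<noteq> 0" for t s
    using supp[of t s] y(2)[of "(t, s)"] that by auto
  have row: "(\<Sum>s=2..T+1. y (t, s)) = (\<Sum>s=2..T+1. x (t, s))" if "t \<in> {1..T}" for t
    using eq[of "(0, t)"] that by (simp add: f_def)
  have col: "unserved y T s = unserved x T s" if "s \<in> {2..T+1}" for s
  proof -
    have "s - 1 \<in> {1..T}" "s - 1 + 1 = s" using that by auto
    then show ?thesis using eq[of "(1, s - 1)"] by (simp add: f_def unserved_def)
  qed
  have weighted: "(\<Sum>s=2..T+1. \<gamma> t s * unserved y t s) = (\<Sum>s=2..T+1. \<gamma> t s * unserved x t s)"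
    if "t \<in> {1..T}" for t
    using eq[of "(2, t)"] that by (simp add: f_def unserved_def right_diff_distrib sum_subtractf)
  have slope: "cost_slope y \<gamma> T s = cost_slope x \<gamma> T s" if "s \<in> {2..T+1}" for s
  proof -
    have "cost_slope w \<gamma> T s = f (3, s - 1) w - (\<Sum>t=1..T. \<gamma> t s * gap s)" for w
      using that by (simp add: f_def cost_slope_def unserved_def right_diff_distrib sum_subtractf sum.distrib)
    moreover have "s - 1 \<in> {1..T}" using that by auto
    ultimately show ?thesis using eq[of "(3, s - 1)"] by simp
  qed
  have total: "(\<Sum>s=2..t+1. unserved y t s) = (\<Sum>s=2..t+1. unserved x t s)" if "t \<in> {1..T}" for t
  proof -
    have "(\<Sum>s=2..t+1. w (\<tau>, s)) = (\<Sum>s=2..T+1. w (\<tau>, s))"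
      if "\<And>s. w (\<tau>, s) \<noteq> 0 \<Longrightarrow> s \<le> \<tau>" "\<tau> \<in> {1..t}" for w :: "nat \<times> nat \<Rightarrow> real" and \<tau>
      by (rule sum.mono_neutral_left) (use that \<open>t \<in> {1..T}\<close> in force)+
    then have "(\<Sum>s=2..t+1. y (\<tau>, s)) = (\<Sum>s=2..t+1. x (\<tau>, s))" if "\<tau> \<in> {1..t}" for \<tau>
      using that row[of \<tau>] \<open>t \<in> {1..T}\<close> supp ysupp by auto
    then have "(\<Sum>\<tau>=1..t. \<Sum>s=2..t+1. y (\<tau>, s)) = (\<Sum>\<tau>=1..t. \<Sum>s=2..t+1. x (\<tau>, s))"
      by (rule sum.cong[OF refl])
    then show ?thesis unfolding unserved_def sum_subtractf
      by (subst (1 2) sum.swap) simp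
  qed
  have final: "(\<Sum>s=2..T+1. cost_slope y \<gamma> T s * u s) = (\<Sum>s=2..T+1. cost_slope x \<gamma> T s * u s)" for u
    by (rule sum.cong) (use slope in auto)
  have "certificate T x0 y z \<gamma>"
    using cert y(1) ysupp unfolding certificate_def final
    by (simp add: col cost_to_go_end weighted[folded Suc_eq_plus1] total[folded Suc_eq_plus1]
        row[folded Suc_eq_plus1] del: sum.cl_ivl_Suc)
  then show ?thesis using card by auto
qed

text \<open>
  Substituting \<open>u s = (\<zeta> s - Dlo s) / gap s\<close> turns the affine orders into a decision rule that is linear in \<open>\<zeta>\<close>; the
  constant terms are collected in the coefficient of \<open>\<zeta> 1 = 1\<close>, which adds at most one nonzero entry per period.
\<close>
lemma certificate_realised:
  assumes cert: "certificate T x0 x z \<gamma>"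
  shows "\<exists>y\<in>ldr_feasible T p Dlo Dhi. worst_case_cost T v1 c h b Dlo Dhi y \<le> cost_to_go 1 v1
    \<and> ldr_nnz T y \<le> T + card {j. x j \<noteq> 0}"
proof -
  have x: "\<And>j. 0 \<le> x j" and supp: "\<And>t s. x (t, s) \<noteq> 0 \<Longrightarrow> 2 \<le> s \<and> s \<le> t \<and> t \<le> T"
    and uns: "\<And>s. s \<in> {2..T+1} \<Longrightarrow> 0 \<le> unserved x T s"
    and per: "\<And>t. t \<in> {1..T} \<Longrightarrow> 0 \<le> x0 t \<and> x0 t + (\<Sum>s=2..T+1. x (t, s)) \<le> p t \<and>
      (\<forall>s. - b t \<le> \<gamma> t s \<and> \<gamma> t s \<le> h t) \<and> (\<forall>s. s \<notin> {2..t+1} \<longrightarrow> \<gamma> t s = 0) \<and>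
      h t * base_inventory x0 t \<le> z t \<and>
      - b t * (base_inventory x0 t - (\<Sum>s=2..t+1. unserved x t s))
        \<le> z t - (\<Sum>s=2..T+1. \<gamma> t s * unserved x t s)"
    and bnd: "\<And>u. u \<in> unit_box \<Longrightarrow>
      (\<Sum>t=1..T. c t * x0 t + z t) + (\<Sum>s=2..T+1. cost_slope x \<gamma> T s * u s) \<le> cost_to_go 1 v1"
    using cert unfolding certificate_def by (blast, blast, blast, blast, simp add: cost_to_go_end)
  have x_late: "x (t, s) = 0" if "t < s" for t s using supp[of t s] that by (cases "x (t, s) = 0") auto
  have gap_pos: "0 < gap s" if "s \<in> {2..T+1}" for s using demand_interval[OF that] by (simp add: gap_def)
  have unst: "0 \<le> unserved x t s" if "t \<le> T" "s \<in> {2..T+1}" for t s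
  proof -
    have "(\<Sum>\<tau>=1..t. x (\<tau>, s)) \<le> (\<Sum>\<tau>=1..T. x (\<tau>, s))"
      by (rule sum_mono2) (use that x in auto)
    then show ?thesis using uns[OF that(2)] by (simp add: unserved_def)
  qed
  define y where "y = (\<lambda>t s. if s = 1 then x0 t - (\<Sum>r=2..T+1. x (t, r) / gap r * Dlo r)
     else x (t, s) / gap s)"
  define U where "U = (\<lambda>\<zeta> s. if s \<in> {2..T+1} then (\<zeta> s - Dlo s) / gap s else 0)"
  have U: "U \<zeta> \<in> unit_box" and demand: "\<And>s. s \<in> {2..T+1} \<Longrightarrow> \<zeta> s = Dlo s + gap s * U \<zeta> s"
    and one: "\<zeta> 1 = 1" if "\<zeta> \<in> uncertainty" for \<zeta>
  proof -
    have \<zeta>: "Dlo s \<le> \<zeta> s \<and> \<zeta> s \<le> Dhi s" if "s \<in> {1..T+1}" for s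
      using \<open>\<zeta> \<in> uncertainty\<close> that by (auto simp: uncertainty_set_def PiE_iff)
    show "U \<zeta> \<in> unit_box" unfolding unit_box_def
    proof (intro CollectI allI)
      fix s
      show "0 \<le> U \<zeta> s \<and> U \<zeta> s \<le> 1"
        using \<zeta>[of s] gap_pos[of s] by (auto simp: U_def gap_def field_simps)
    qed
    show "\<zeta> s = Dlo s + gap s * U \<zeta> s" if "s \<in> {2..T+1}" for s
      using gap_pos[OF that] that by (simp add: U_def)
    show "\<zeta> 1 = 1" using \<zeta>[of 1] first_demand by simp
  qed
  have order: "ldr_order y \<zeta> t = x0 t + (\<Sum>s=2..T+1. x (t, s) * U \<zeta> s)"
    if \<zeta>: "\<zeta> \<in> uncertainty" and t: "t \<in> {1..T}" for \<zeta> t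
  proof -
    have "{1..t} = insert 1 {2..t}" using t by auto
    then have "ldr_order y \<zeta> t = y t 1 + (\<Sum>s=2..t. y t s * \<zeta> s)"
      unfolding ldr_order_def by (simp add: one[OF \<zeta>, simplified])
    also have "(\<Sum>s=2..t. y t s * \<zeta> s) = (\<Sum>s=2..t. x (t, s) / gap s * \<zeta> s)"
      by (rule sum.cong) (auto simp: y_def)
    also have "\<dots> = (\<Sum>s=2..T+1. x (t, s) / gap s * \<zeta> s)"
      by (rule sum.mono_neutral_left) (use t x_late in auto)
    also have "\<dots> = (\<Sum>s=2..T+1. x (t, s) / gap s * Dlo s + x (t, s) * U \<zeta> s)"
    proof (rule sum.cong[OF refl])
      fix s assume s: "s \<in> {2..T+1}"
      show "x (t, s) / gap s * \<zeta> s = x (t, s) / gap s * Dlo s + x (t, s) * U \<zeta> s"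
        unfolding demand[OF \<zeta> s] using gap_pos[OF s] by (simp add: field_simps)
    qed
    finally show ?thesis by (simp add: y_def sum.distrib del: sum.cl_ivl_Suc)
  qed
  have inv: "inventory (ldr_order y \<zeta>) \<zeta> t = base_inventory x0 t - (\<Sum>s=2..t+1. unserved x t s * U \<zeta> s)"
    if \<zeta>: "\<zeta> \<in> uncertainty" and t: "t \<in> {1..T}" for \<zeta> t
  proof -
    have "(\<Sum>\<tau>=1..t. ldr_order y \<zeta> \<tau>) = (\<Sum>\<tau>=1..t. x0 \<tau> + (\<Sum>s=2..T+1. x (\<tau>, s) * U \<zeta> s))"
      by (rule sum.cong) (use order[OF \<zeta>] t in auto)
    also have "\<dots> = (\<Sum>\<tau>=1..t. x0 \<tau>) + (\<Sum>\<tau>=1..t. \<Sum>s=2..T+1. x (\<tau>, s) * U \<zeta> s)"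
      by (rule sum.distrib)
    also have "(\<Sum>\<tau>=1..t. \<Sum>s=2..T+1. x (\<tau>, s) * U \<zeta> s) = (\<Sum>\<tau>=1..t. \<Sum>s=2..t+1. x (\<tau>, s) * U \<zeta> s)"
      by (rule sum.cong[OF refl], rule sum.mono_neutral_right) (use t x_late in auto)
    also have "\<dots> = (\<Sum>s=2..t+1. (\<Sum>\<tau>=1..t. x (\<tau>, s)) * U \<zeta> s)"
      by (subst sum.swap) (simp add: sum_distrib_right)
    finally have orders: "(\<Sum>\<tau>=1..t. ldr_order y \<zeta> \<tau>)
      = (\<Sum>\<tau>=1..t. x0 \<tau>) + (\<Sum>s=2..t+1. (\<Sum>\<tau>=1..t. x (\<tau>, s)) * U \<zeta> s)" .
    have "(\<Sum>s=2..t+1. \<zeta> s) = (\<Sum>s=2..t+1. Dlo s + gap s * U \<zeta> s)"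
      by (rule sum.cong) (use demand[OF \<zeta>] t in auto)
    with orders show ?thesis
      unfolding inventory_def base_inventory_def unserved_def
      by (simp add: sum.distrib sum_subtractf left_diff_distrib del: sum.cl_ivl_Suc)
  qed
  have stage: "stage_cost (h t) (b t) (inventory (ldr_order y \<zeta>) \<zeta> t)
      \<le> z t - (\<Sum>s=2..T+1. \<gamma> t s * unserved x t s * U \<zeta> s)"
    if \<zeta>: "\<zeta> \<in> uncertainty" and t: "t \<in> {1..T}" for \<zeta> t
  proof -
    let ?S = "{2..t+1}" and ?r = "unserved x t"
    have u: "0 \<le> U \<zeta> s" "U \<zeta> s \<le> 1" for s using unit_boxD[OF U[OF \<zeta>]] by auto
    have r: "0 \<le> ?r s" if "s \<in> ?S" for s using that t by (intro unst) auto
    have \<gamma>: "- b t \<le> \<gamma> t s" "\<gamma> t s \<le> h t" for s using per[OF t] by auto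
    have restrict: "(\<Sum>s=2..T+1. \<gamma> t s * g s) = (\<Sum>s\<in>?S. \<gamma> t s * g s)" for g
      by (rule sum.mono_neutral_right) (use t per[OF t] in auto)
    have "(\<Sum>s\<in>?S. \<gamma> t s * (?r s * U \<zeta> s)) \<le> (\<Sum>s\<in>?S. h t * (?r s * U \<zeta> s))"
      by (intro sum_mono mult_right_mono \<gamma> mult_nonneg_nonneg r u) auto
    then have hold: "h t * (base_inventory x0 t - (\<Sum>s\<in>?S. ?r s * U \<zeta> s))
        \<le> z t - (\<Sum>s\<in>?S. \<gamma> t s * (?r s * U \<zeta> s))"
      using per[OF t] by (simp add: right_diff_distrib del: sum.cl_ivl_Suc flip: sum_distrib_left)
    have "(\<Sum>s\<in>?S. - b t * (?r s * (1 - U \<zeta> s))) \<le> (\<Sum>s\<in>?S. \<gamma> t s * (?r s * (1 - U \<zeta> s)))"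
      by (intro sum_mono mult_right_mono \<gamma> mult_nonneg_nonneg r) (use u in auto)
    then have "- b t * ((\<Sum>s\<in>?S. ?r s) - (\<Sum>s\<in>?S. ?r s * U \<zeta> s))
        \<le> (\<Sum>s\<in>?S. \<gamma> t s * ?r s) - (\<Sum>s\<in>?S. \<gamma> t s * (?r s * U \<zeta> s))"
      unfolding sum_distrib_left[symmetric] sum_subtractf[symmetric]
      by (simp add: right_diff_distrib del: sum.cl_ivl_Suc)
    moreover have "- b t * (base_inventory x0 t - (\<Sum>s\<in>?S. ?r s)) \<le> z t - (\<Sum>s\<in>?S. \<gamma> t s * ?r s)"
      using per[OF t] restrict[of ?r] by simp
    ultimately have back_order: "- b t * (base_inventory x0 t - (\<Sum>s\<in>?S. ?r s * U \<zeta> s))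
        \<le> z t - (\<Sum>s\<in>?S. \<gamma> t s * (?r s * U \<zeta> s))"
      by (simp add: right_diff_distrib del: sum.cl_ivl_Suc)
    show ?thesis
      unfolding inv[OF \<zeta> t] stage_cost_def mult.assoc restrict
      using hold back_order by (simp del: sum.cl_ivl_Suc)
  qed
  have feasible: "y \<in> ldr_feasible T p Dlo Dhi"
    unfolding ldr_feasible_def
  proof (intro CollectI ballI conjI)
    fix t \<zeta> assume t: "t \<in> {1..T}" and \<zeta>: "\<zeta> \<in> uncertainty"
    have u: "0 \<le> U \<zeta> s" "U \<zeta> s \<le> 1" for s using unit_boxD[OF U[OF \<zeta>]] by auto
    have "0 \<le> (\<Sum>s=2..T+1. x (t, s) * U \<zeta> s)" by (intro sum_nonneg mult_nonneg_nonneg x u)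
    moreover have "(\<Sum>s=2..T+1. x (t, s) * U \<zeta> s) \<le> (\<Sum>s=2..T+1. x (t, s))"
      by (intro sum_mono mult_left_le x u)
    ultimately show "0 \<le> ldr_order y \<zeta> t" "ldr_order y \<zeta> t \<le> p t"
      using per[OF t] unfolding order[OF \<zeta> t] by linarith+
  qed
  have cost: "newsvendor_cost T v1 c h b (ldr_order y \<zeta>) \<zeta> \<le> cost_to_go 1 v1"
    if \<zeta>: "\<zeta> \<in> uncertainty" for \<zeta>
  proof -
    have "newsvendor_cost T v1 c h b (ldr_order y \<zeta>) \<zeta>
      \<le> (\<Sum>t=1..T. c t * x0 t + z t + (\<Sum>s=2..T+1. (c t * x (t, s) - \<gamma> t s * unserved x t s) * U \<zeta> s))"
      unfolding newsvendor_cost_stage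
    proof (rule sum_mono)
      fix t assume t: "t \<in> {1..T}"
      show "c t * ldr_order y \<zeta> t + stage_cost (h t) (b t) (inventory (ldr_order y \<zeta>) \<zeta> t)
        \<le> c t * x0 t + z t + (\<Sum>s=2..T+1. (c t * x (t, s) - \<gamma> t s * unserved x t s) * U \<zeta> s)"
        using stage[OF \<zeta> t] unfolding order[OF \<zeta> t]
        by (simp add: distrib_left left_diff_distrib sum_subtractf sum_distrib_left mult.assoc del: sum.cl_ivl_Suc)
    qed
    also have "\<dots> = (\<Sum>t=1..T. c t * x0 t + z t) + (\<Sum>s=2..T+1. cost_slope x \<gamma> T s * U \<zeta> s)"
      unfolding sum.distrib cost_slope_def sum_distrib_right by (subst sum.swap) simp
    also have "\<dots> \<le> cost_to_go 1 v1" by (rule bnd[OF U[OF \<zeta>]])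
    finally show ?thesis .
  qed
  have "worst_case_cost T v1 c h b Dlo Dhi y \<le> cost_to_go 1 v1"
  proof -
    obtain \<zeta> where "\<zeta> \<in> uncertainty"
      "worst_case_cost T v1 c h b Dlo Dhi y = newsvendor_cost T v1 c h b (ldr_order y \<zeta>) \<zeta>"
      by (rule worst_case_cost_attained[of T Dlo Dhi v1 c h b y], erule demand_le, (rule that; blast))
    then show ?thesis using cost by simp
  qed
  moreover have "ldr_nnz T y \<le> T + card {j. x j \<noteq> 0}"
  proof -
    have "{j. x j \<noteq> 0} \<subseteq> {..T} \<times> {..T}" using supp by fastforce
    then have fin: "finite {j. x j \<noteq> 0}" by (rule finite_subset) simp
    have "{(t, s). 1 \<le> s \<and> s \<le> t \<and> t \<le> T \<and> y t s \<noteq> 0} \<subseteq> (\<lambda>t. (t, 1)) ` {1..T} \<union> {j. x j \<noteq> 0}"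
      by (auto simp: y_def split: if_splits)
    then have "ldr_nnz T y \<le> card ((\<lambda>t. (t, 1)) ` {1..T} \<union> {j. x j \<noteq> 0})"
      unfolding ldr_nnz_def using fin by (intro card_mono) auto
    also have "\<dots> \<le> card ((\<lambda>t. (t, 1::nat)) ` {1..T}) + card {j. x j \<noteq> 0}" by (rule card_Un_le)
    also have "card ((\<lambda>t. (t, 1::nat)) ` {1..T}) \<le> T"
      using card_image_le[of "{1..T}" "\<lambda>t. (t, 1::nat)"] by simp
    finally show ?thesis by simp
  qed
  ultimately show ?thesis using feasible by blast
qed

lemma sparse_optimal_solution:
  "\<exists>y. ldr_optimal_solution T v1 c p h b Dlo Dhi y \<and> ldr_nnz T y \<le> 5 * T"
proof -
  obtain x0 x z \<gamma> where "certificate T x0 x z \<gamma>" using certificate_exists by blast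
  then obtain x' where x': "certificate T x0 x' z \<gamma>" "card {j. x' j \<noteq> 0} \<le> 4 * T"
    using certificate_sparse by blast
  obtain y where "y \<in> ldr_feasible T p Dlo Dhi"
    "worst_case_cost T v1 c h b Dlo Dhi y \<le> cost_to_go 1 v1" "ldr_nnz T y \<le> T + card {j. x' j \<noteq> 0}"
    using certificate_realised[OF x'(1)] by blast
  then show ?thesis using x'(2) cost_to_go_lower_bound
    unfolding ldr_optimal_solution_def by (intro exI[of _ y]) (force intro: order_trans)
qed

end

theorem theorem2:
  fixes T :: nat and v1 :: real and c p h b Dlo Dhi :: "nat \<Rightarrow> real"
  assumes "T \<ge> 1"
    and "\<And>t. t \<in> {1..T} \<Longrightarrow> h t \<ge> 0 \<and> b t \<ge> 0"
    and "Dlo 1 = 1" and "Dhi 1 = 1"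
    and "\<And>t. t \<in> {2..T+1} \<Longrightarrow> Dlo t < Dhi t"
    and "ldr_feasible T p Dlo Dhi \<noteq> {}"
    and "\<bar>ldr_optimal_value T v1 c p h b Dlo Dhi\<bar> \<noteq> \<infinity>"
  shows "\<exists>y. ldr_optimal_solution T v1 c p h b Dlo Dhi y \<and> ldr_nnz T y \<le> 10 + 12 * T"
proof -
  have demand: "Dlo t \<le> Dhi t" if "t \<in> {1..T+1}" for t
    using assms(3-5) that by (cases "t = 1") (auto simp: less_imp_le)
  obtain y where y: "y \<in> ldr_feasible T p Dlo Dhi" using assms(6) by blast
  have "restrict Dlo {1..T+1} \<in> uncertainty_set T Dlo Dhi"
    using demand by (auto simp: uncertainty_set_def PiE_iff)
  then have "0 \<le> p t" if "t \<in> {1..T}" for t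
    using y that unfolding ldr_feasible_def by fastforce
  then interpret newsvendor T v1 c p h b Dlo Dhi
    by unfold_locales (use assms(2-5) in auto)
  obtain y where "ldr_optimal_solution T v1 c p h b Dlo Dhi y" "ldr_nnz T y \<le> 5 * T"
    using sparse_optimal_solution by blast
  then show ?thesis by (intro exI[of _ y]) simp
qed

end
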